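(* Let $\kappa$ be a weakly compact cardinal. Then $\mathrm{id}^-(\mathbb Q_\kappa)=\mathrm{wid}(\mathbb Q_\kappa)$.
   Context: For a cardinal $\lambda$, $S^\lambda_{\mathrm{inc}}$ is the set of strongly inaccessible cardinals below $\lambda$. A set $S\subseteq\lambda$ is nowhere stationary if for every $\delta\le\lambda$ of uncountable cofinality, $S\cap\delta$ is nonstationary in $\delta$. By induction on strongly inaccessible $\lambda$ one defines a forcing $\mathbb Q_\lambda$ and an ideal $\mathrm{id}(\mathbb Q_\lambda)$ on $2^\lambda$: $p\in\mathbb Q_\lambda$ iff $p\subseteq 2^{<\lambda}$ is closed under initial segments and there is a witness $(\tau,S,\langle N_\delta:\delta\in S\rangle)$ with: (i) $\tau$ is the trunk of $p$, the least node of $p$ having two immediate successors in $p$; (ii) if $\tau\trianglelefteq\eta\in p$ then $\eta^\frown0,\eta^\frown1\in p$; (iii) $S\subseteq S^\lambda_{\mathrm{inc}}$ is nowhere stationary; (iv) $N_\delta\in\mathrm{id}(\mathbb Q_\delta)$ for $\delta\in S$; (v) for limit $\delta<\lambda$ with $\delta\notin S$ and $\eta\in2^\delta$: $\eta\in p$ iff $\eta\restriction\sigma\in p$ for all $\sigma<\delta$; (vi) for $\delta\in S$ and $\eta\in 2^\delta$: $\eta\in p$ iff $\eta\restriction\sigma\in p$ for all $\sigma<\delta$ and $\eta\notin N_\delta$. The order is $q\le p$ iff $q\subseteq p$. $[p]$ is the set of $x\in 2^\lambda$ all of whose proper initial segments lie in $p$; for $\mathcal J\subseteq\mathbb Q_\lambda$,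 $\mathrm{set}_0(\mathcal J)=2^\lambda\setminus\bigcup_{p\in\mathcal J}[p]$. $A\in\mathrm{id}(\mathbb Q_\lambda)$ iff there are at most $\lambda$ predense sets $\mathcal J_i\subseteq\mathbb Q_\lambda$ with $A\subseteq\bigcup_i\mathrm{set}_0(\mathcal J_i)$. $\mathrm{wid}(\mathbb Q_\kappa)$ is the family of $A\subseteq2^\kappa$ with $A\subseteq\mathrm{set}_0(\mathcal A)$ for some maximal antichain $\mathcal A\subseteq\mathbb Q_\kappa$. $\mathrm{id}^-(\mathbb Q_\kappa)$ is the family of $A\subseteq 2^\kappa$ for which there are a nowhere stationary $S\subseteq S^\kappa_{\mathrm{inc}}$ and sets $N_\delta\in\mathrm{id}(\mathbb Q_\delta)$ ($\delta\in S$) with $A\subseteq\{\eta\in2^\kappa:\{\delta\in S:\eta\restriction\delta\in N_\delta\}\text{ is unbounded in }\kappa\}$. *)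

theory Defs
  imports Main "HOL-Library.Equipollence" "HOL-Library.Countable_Set"
begin

text \<open>Convention: the cardinal kappa is the order type of a well-ordered type 'k
  (so ordinals below kappa are elements of 'k).  An ordinal delta \<le> kappa is
  represented by a downward closed set D: either seg a (for a < kappa) or UNIV (for kappa).\<close>

type_synonym 'k node = "'k \<times> ('k \<Rightarrow> bool)"

definition oseg :: "'k::wellorder \<Rightarrow> 'k set" where
  "oseg a = {y. y < a}"

definition is_limit :: "'k::wellorder \<Rightarrow> bool" where
  "is_limit a \<longleftrightarrow> (\<exists>z. z < a) \<and> (\<forall>z<a. \<exists>w. z < w \<and> w < a)"

definition cofinal_in :: "'k::wellorder set \<Rightarrow> 'k set \<Rightarrow> bool" where
  "cofinal_in C D \<longleftrightarrow> C \<subseteq> D \<and> (\<forall>y\<in>D. \<exists>c\<in>C. y \<le> c)"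

definition uncountable_cof :: "'k::wellorder set \<Rightarrow> bool" where
  "uncountable_cof D \<longleftrightarrow> (\<forall>C. cofinal_in C D \<longrightarrow> \<not> countable C)"

definition club_in :: "'k::wellorder set \<Rightarrow> 'k set \<Rightarrow> bool" where
  "club_in D C \<longleftrightarrow> cofinal_in C D \<and>
     (\<forall>y\<in>D. is_limit y \<and> cofinal_in (C \<inter> oseg y) (oseg y) \<longrightarrow> y \<in> C)"

definition nonstationary_in :: "'k::wellorder set \<Rightarrow> 'k set \<Rightarrow> bool" where
  "nonstationary_in D X \<longleftrightarrow> (\<exists>C. club_in D C \<and> C \<inter> X = {})"

definition nowhere_stationary :: "'k::wellorder set \<Rightarrow> 'k set \<Rightarrow> bool" where
  "nowhere_stationary D S \<longleftrightarrow> S \<subseteq> D \<and>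
     (\<forall>D' \<in> insert D (oseg ` D). uncountable_cof D' \<longrightarrow> nonstationary_in D' (S \<inter> D'))"

definition strongly_inaccessible :: "'k::wellorder \<Rightarrow> bool" where
  "strongly_inaccessible a \<longleftrightarrow>
     \<not> countable (oseg a) \<and>
     (\<forall>b<a. oseg b \<prec> oseg a) \<and>
     (\<forall>C. cofinal_in C (oseg a) \<longrightarrow> C \<approx> oseg a) \<and>
     (\<forall>b<a. Pow (oseg b) \<prec> oseg a)"

definition S_inc :: "'k::wellorder set \<Rightarrow> 'k set" where
  "S_inc D = {d \<in> D. strongly_inaccessible d}"

definition weakly_compact :: "'k::wellorder itself \<Rightarrow> bool" where
  "weakly_compact _ \<longleftrightarrow>
     \<not> countable (UNIV :: 'k set) \<and>
     (\<forall>a::'k. oseg a \<prec> (UNIV :: 'k set)) \<and>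
     (\<forall>c :: 'k \<Rightarrow> 'k \<Rightarrow> bool. \<exists>H. H \<approx> (UNIV :: 'k set) \<and>
         (\<exists>b. \<forall>x\<in>H. \<forall>y\<in>H. x < y \<longrightarrow> c x y = b))"

text \<open>2^{<D}: nodes (alpha, f) with alpha \<in> D, f zero from alpha on.\<close>
definition nodes :: "'k::wellorder set \<Rightarrow> 'k node set" where
  "nodes D = {\<eta>. fst \<eta> \<in> D \<and> (\<forall>y. fst \<eta> \<le> y \<longrightarrow> snd \<eta> y = False)}"

text \<open>2^D: functions vanishing outside D.\<close>
definition funs :: "'k::wellorder set \<Rightarrow> ('k \<Rightarrow> bool) set" where
  "funs D = {x. \<forall>y. y \<notin> D \<longrightarrow> x y = False}"

definition restr :: "('k::wellorder \<Rightarrow> bool) \<Rightarrow> 'k \<Rightarrow> 'k node" where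
  "restr x s = (s, \<lambda>y. if y < s then x y else False)"

definition initseg :: "'k::wellorder node \<Rightarrow> 'k node \<Rightarrow> bool" where
  "initseg \<eta> \<nu> \<longleftrightarrow> fst \<eta> \<le> fst \<nu> \<and> (\<forall>y < fst \<eta>. snd \<eta> y = snd \<nu> y)"

definition extn :: "'k::wellorder node \<Rightarrow> bool \<Rightarrow> 'k node" where
  "extn \<eta> b = Pair (LEAST z. fst \<eta> < z) ((snd \<eta>)(fst \<eta> := b))"

definition Qset :: "'k::wellorder set \<Rightarrow> ('k \<Rightarrow> ('k \<Rightarrow> bool) set set) \<Rightarrow> 'k node set set" where
  "Qset D I = {p. p \<subseteq> nodes D \<and> (\<forall>\<eta>\<in>p. \<forall>s\<le>fst \<eta>. restr (snd \<eta>) s \<in> p) \<and>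
     (\<exists>\<tau> S N.
        \<tau> \<in> p \<and> extn \<tau> False \<in> p \<and> extn \<tau> True \<in> p \<and>
        (\<forall>\<nu>\<in>p. extn \<nu> False \<in> p \<and> extn \<nu> True \<in> p \<longrightarrow> initseg \<tau> \<nu>) \<and>
        (\<forall>\<eta>\<in>p. initseg \<tau> \<eta> \<longrightarrow> extn \<eta> False \<in> p \<and> extn \<eta> True \<in> p) \<and>
        S \<subseteq> S_inc D \<and> nowhere_stationary D S \<and>
        (\<forall>d\<in>S. N d \<in> I d) \<and>
        (\<forall>d\<in>D. is_limit d \<and> d \<notin> S \<longrightarrow>
           (\<forall>\<eta>\<in>nodes D. fst \<eta> = d \<longrightarrow> (\<eta> \<in> p \<longleftrightarrow> (\<forall>s<d. restr (snd \<eta>) s \<in> p)))) \<and>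
        (\<forall>d\<in>S. \<forall>\<eta>\<in>nodes D. fst \<eta> = d \<longrightarrow>
           (\<eta> \<in> p \<longleftrightarrow> (\<forall>s<d. restr (snd \<eta>) s \<in> p) \<and> snd \<eta> \<notin> N d)))}"

definition branches :: "'k::wellorder set \<Rightarrow> 'k node set \<Rightarrow> ('k \<Rightarrow> bool) set" where
  "branches D p = {x \<in> funs D. \<forall>s\<in>D. restr x s \<in> p}"

definition set0 :: "'k::wellorder set \<Rightarrow> 'k node set set \<Rightarrow> ('k \<Rightarrow> bool) set" where
  "set0 D J = funs D - (\<Union>p\<in>J. branches D p)"

definition compatible :: "'a set set \<Rightarrow> 'a set \<Rightarrow> 'a set \<Rightarrow> bool" where
  "compatible Q p q \<longleftrightarrow> (\<exists>r\<in>Q. r \<subseteq> p \<and> r \<subseteq> q)"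

definition predense :: "'a set set \<Rightarrow> 'a set set \<Rightarrow> bool" where
  "predense Q J \<longleftrightarrow> J \<subseteq> Q \<and> (\<forall>q\<in>Q. \<exists>p\<in>J. compatible Q p q)"

definition max_antichain :: "'a set set \<Rightarrow> 'a set set \<Rightarrow> bool" where
  "max_antichain Q A \<longleftrightarrow> A \<subseteq> Q \<and>
     (\<forall>p\<in>A. \<forall>p'\<in>A. p \<noteq> p' \<longrightarrow> \<not> compatible Q p p') \<and>
     (\<forall>q\<in>Q. \<exists>p\<in>A. compatible Q p q)"

definition idset :: "'k::wellorder set \<Rightarrow> ('k \<Rightarrow> ('k \<Rightarrow> bool) set set) \<Rightarrow> ('k \<Rightarrow> bool) set set" where
  "idset D I = {A. A \<subseteq> funs D \<and>
     (\<exists>Js :: 'k \<Rightarrow> 'k node set set. (\<forall>i\<in>D. predense (Qset D I) (Js i)) \<and>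
        A \<subseteq> (\<Union>i\<in>D. set0 D (Js i)))}"

text \<open>id(Q_delta) for delta < kappa, by well-founded recursion (meaningful for
  strongly inaccessible delta).\<close>
definition idQ :: "'k::wellorder \<Rightarrow> ('k \<Rightarrow> bool) set set" where
  "idQ = wfrec {(x, y). x < y} (\<lambda>F d. idset (oseg d) F)"

definition QK :: "'k::wellorder node set set" where
  "QK = Qset UNIV idQ"

definition wid :: "('k::wellorder \<Rightarrow> bool) set set" where
  "wid = {A. A \<subseteq> funs UNIV \<and> (\<exists>\<A>. max_antichain QK \<A> \<and> A \<subseteq> set0 UNIV \<A>)}"

definition id_minus :: "('k::wellorder \<Rightarrow> bool) set set" where
  "id_minus = {A. A \<subseteq> funs UNIV \<and>
     (\<exists>S N. S \<subseteq> S_inc UNIV \<and> nowhere_stationary UNIV S \<and> (\<forall>d\<in>S. N d \<in> idQ d) \<and>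
        A \<subseteq> {x \<in> funs UNIV. \<forall>a. \<exists>d\<in>S. a \<le> d \<and> snd (restr x d) \<in> N d})}"

end

theory Submission
  imports Defs
begin

text \<open>
  Two conditions are compatible iff their trunks are comparable and the longer trunk belongs
  to the other condition, so compatibility is decided below any level bounding both trunks.

  Given \<open>S\<close> and \<open>N\<close>, the conditions whose gaps above the trunk contain \<open>N\<close> are dense, and a
  branch of such a condition meets \<open>N\<close> only boundedly often. A maximal antichain of
  conditions below them shows \<open>id\<^sup>- \<subseteq> wid\<close>, for any \<open>\<kappa>\<close>.

  For the converse let \<open>A\<close> be a maximal antichain; its members are determined by their trunks.
  If the trace of \<open>A\<close> on \<open>\<delta>\<close> failed to be predense, as witnessed by conditions \<open>q\<^sub>\<delta>\<close> with one
  fixed trunk, for unboundedly many inaccessible \<open>\<delta>\<close>, then a limit of these \<open>q\<^sub>\<delta>\<close> would be a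
  condition incompatible with all of \<open>A\<close>. Hence the trace is predense on an unbounded and, after
  thinning out, nowhere stationary set of inaccessible \<open>\<delta>\<close>. Let \<open>N\<^sub>\<delta>\<close> consist of the points
  missed by the trace together with the gaps at \<open>\<delta>\<close> of the members of \<open>A\<close> with trunk shorter
  than \<open>\<delta>\<close>. A point that avoids \<open>N\<close> from such a \<open>\<delta>\<close> on runs through some member of \<open>A\<close> up to
  \<open>\<delta>\<close>, and never meets a gap of it later.

  The partition relation supplies limits of \<open>\<kappa>\<close>-sequences in powers of 2, hence
  inaccessibility of \<open>\<kappa>\<close>, unbounded sets on which \<open>\<kappa>\<close> many regressive functions are eventually
  constant, and from these the reflection of stationary sets.
\<close>

section \<open>Cardinality\<close>

lemma lepoll_iff_ordLeq: "A \<lesssim> B \<longleftrightarrow> (card_of A, card_of B) \<in> ordLeq"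
  by (simp add: lepoll_def card_of_ordLeq)

lemma not_lesspoll_imp_lepoll:
  assumes "\<not> A \<prec> B" shows "B \<lesssim> A"
  using assms ordLeq_total[OF card_of_Well_order card_of_Well_order, of A B]
  by (metis lepoll_iff_ordLeq lesspoll_def eqpoll_imp_lepoll eqpoll_sym)

lemma UN_lepoll_infinite:
  assumes "infinite B" "I \<lesssim> B" "\<And>i. i \<in> I \<Longrightarrow> A i \<lesssim> B"
  shows "(\<Union>i\<in>I. A i) \<lesssim> B"
  using card_of_UNION_ordLeq_infinite[of B I A] assms by (simp add: lepoll_iff_ordLeq)

lemma Times_lepoll_infinite:
  assumes "infinite B" "I \<lesssim> B" "J \<lesssim> B"
  shows "I \<times> J \<lesssim> B"
  using card_of_Sigma_ordLeq_infinite[of B I "\<lambda>_. J"] assms by (simp add: lepoll_iff_ordLeq)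

lemma Un_lepoll_infinite:
  assumes "infinite C" "A \<lesssim> C" "B \<lesssim> C" shows "A \<union> B \<lesssim> C"
proof -
  have "(\<Union>b\<in>(UNIV::bool set). if b then A else B) \<lesssim> C"
    using assms by (intro UN_lepoll_infinite) (auto simp: finite_lepoll_infinite)
  moreover have "A \<union> B \<subseteq> (\<Union>b\<in>(UNIV::bool set). if b then A else B)"
    by (auto simp: UNIV_bool)
  ultimately show ?thesis by (meson lepoll_trans subset_imp_lepoll)
qed

lemma oseg_subset: "a \<le> b \<Longrightarrow> oseg a \<subseteq> oseg b"
  by (auto simp: oseg_def)

lemma mem_oseg [simp]: "x \<in> oseg a \<longleftrightarrow> x < a"
  by (simp add: oseg_def)

section \<open>Clubs and nowhere stationary sets\<close>

text \<open>Stands for being an ordinal at most \<kappa>. Both \<open>UNIV\<close> and all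
  \<open>oseg a\<close> qualify, so the club lemmas treat \<kappa> and the ordinals below it
  together.\<close>

definition down :: "'k::wellorder set \<Rightarrow> bool" where
  "down D \<longleftrightarrow> (\<forall>x\<in>D. \<forall>y<x. y \<in> D)"

lemma down_UNIV [simp]: "down UNIV" and down_oseg [simp]: "down (oseg a)"
  by (auto simp: down_def)

lemma downD: "\<lbrakk>down D; x \<in> D; y < x\<rbrakk> \<Longrightarrow> y \<in> D"
  by (auto simp: down_def)

lemma cofinal_in_Int_oseg:
  "cofinal_in (C \<inter> oseg y) (oseg y) \<longleftrightarrow> (\<forall>z<y. \<exists>c\<in>C. z \<le> c \<and> c < y)"
  unfolding cofinal_in_def Ball_def Bex_def mem_oseg Int_iff by blast

lemma cofinal_inD: "\<lbrakk>cofinal_in C D; y \<in> D\<rbrakk> \<Longrightarrow> \<exists>c\<in>C. y \<le> c"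
  by (simp add: cofinal_in_def)

text \<open>A greatest point would form a one-element cofinal set.\<close>

lemma uncountable_cof_gt:
  assumes "uncountable_cof D" "y \<in> D" shows "\<exists>z\<in>D. y < z"
proof -
  have "\<not> cofinal_in {y} D" using assms(1) unfolding uncountable_cof_def by blast
  then show ?thesis using assms(2) by (auto simp: cofinal_in_def not_le)
qed

lemma uncountable_cof_seq:
  assumes "uncountable_cof D" "\<forall>n::nat. y n \<in> D" shows "\<exists>z\<in>D. \<forall>n. y n < z"
proof -
  have "countable (range y)" by simp
  then have "\<not> cofinal_in (range y) D" using assms(1) unfolding uncountable_cof_def by blast
  then show ?thesis using assms(2) by (auto simp: cofinal_in_def not_le)
qed

lemma uncountable_cof_sup:
  assumes "down D" "uncountable_cof D" "\<forall>n::nat. y n \<in> D" "\<forall>n. y n < y (Suc n)"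
  obtains u where "u \<in> D" "is_limit u" "\<forall>n. y n < u" "\<forall>z<u. \<exists>n. z < y n"
proof -
  obtain z where z: "z \<in> D" "\<forall>n. y n < z" using uncountable_cof_seq assms by blast
  \<comment> \<open>The supremum is taken as the least strict upper bound. As \<open>y\<close> is
    strictly increasing, it is a limit.\<close>
  define u where "u = (LEAST u. \<forall>n. y n < u)"
  have u: "\<forall>n. y n < u" unfolding u_def using z(2) by (rule LeastI)
  have "u \<le> z" unfolding u_def using z(2) by (rule Least_le)
  then have "u \<in> D" using z(1) downD[OF assms(1) z(1)] by (auto simp: le_less)
  have below: "\<exists>n. w < y n" if "w < u" for w
  proof -
    have "\<not> (\<forall>n. y n < w)" using that unfolding u_def by (rule not_less_Least)
    then obtain n where "w \<le> y n" by (auto simp: not_less)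
    then show ?thesis using assms(4) by (meson le_less_trans)
  qed
  then have "is_limit u" using u unfolding is_limit_def by blast
  then show ?thesis using that u \<open>u \<in> D\<close> below by blast
qed

lemma club_inD:
  assumes "club_in D C"
  shows "C \<subseteq> D" "y \<in> D \<Longrightarrow> \<exists>c\<in>C. y \<le> c"
    "\<lbrakk>y \<in> D; is_limit y; \<forall>z<y. \<exists>c\<in>C. z \<le> c \<and> c < y\<rbrakk> \<Longrightarrow> y \<in> C"
  using assms unfolding club_in_def cofinal_in_Int_oseg by (auto simp: cofinal_in_def)

lemma club_inI:
  assumes "C \<subseteq> D" "\<And>y. y \<in> D \<Longrightarrow> \<exists>c\<in>C. y \<le> c"
    "\<And>y. \<lbrakk>y \<in> D; is_limit y; \<forall>z<y. \<exists>c\<in>C. z \<le> c \<and> c < y\<rbrakk> \<Longrightarrow> y \<in> C"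
  shows "club_in D C"
  using assms unfolding club_in_def cofinal_in_Int_oseg by (auto simp: cofinal_in_def)

text \<open>Both the intersection of few clubs (constant \<open>P\<close>) and the diagonal intersection
  (\<open>P i y\<close> meaning that the index \<open>i\<close> appears before \<open>y\<close>) are instances.\<close>
lemma club_in_diagonal:
  fixes P :: "'i \<Rightarrow> 'k::wellorder \<Rightarrow> bool"
  assumes D: "down D" "uncountable_cof D"
    and C: "\<And>i. i \<in> I \<Longrightarrow> club_in D (C i)"
    and mono: "\<And>i y y'. \<lbrakk>P i y; y \<le> y'\<rbrakk> \<Longrightarrow> P i y'"
    and lim: "\<And>i u. \<lbrakk>P i u; is_limit u\<rbrakk> \<Longrightarrow> \<exists>z<u. P i z"
    and bdd: "\<And>y g. \<lbrakk>y \<in> D; \<forall>i\<in>I. P i y \<longrightarrow> g i \<in> D\<rbrakk> \<Longrightarrow> \<exists>b\<in>D. \<forall>i\<in>I. P i y \<longrightarrow> g i \<le> b"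
  shows "club_in D {y \<in> D. \<forall>i\<in>I. P i y \<longrightarrow> y \<in> C i}"
proof (rule club_inI)
  fix y0 assume y0: "y0 \<in> D"
  have step: "\<exists>y'\<in>D. y < y' \<and> (\<forall>i\<in>I. P i y \<longrightarrow> (\<exists>c\<in>C i. y < c \<and> c \<le> y'))" if y: "y \<in> D" for y
  proof -
    obtain y1 where y1: "y1 \<in> D" "y < y1" using uncountable_cof_gt[OF D(2) y] by blast
    have "\<forall>i\<in>I. \<exists>c. c \<in> C i \<and> y1 \<le> c" using club_inD(2)[OF C y1(1)] by blast
    from bchoice[OF this] obtain g where g: "\<forall>i\<in>I. g i \<in> C i \<and> y1 \<le> g i" by blast
    then have "\<forall>i\<in>I. P i y \<longrightarrow> g i \<in> D" using club_inD(1)[OF C] by blast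
    then obtain b where b: "b \<in> D" "\<forall>i\<in>I. P i y \<longrightarrow> g i \<le> b" using bdd[OF y] by blast
    have "max y1 b \<in> D" using y1(1) b(1) by (simp add: max_def)
    moreover have "y < max y1 b" using y1(2) by (simp add: less_max_iff_disj)
    moreover have "\<forall>i\<in>I. P i y \<longrightarrow> (\<exists>c\<in>C i. y < c \<and> c \<le> max y1 b)"
      using g b(2) y1(2) by (meson le_max_iff_disj less_le_trans)
    ultimately show ?thesis by blast
  qed
  \<comment> \<open>Each interval from \<open>f n\<close> to \<open>f (Suc n)\<close> meets every
    club whose index has appeared by \<open>f n\<close>. The supremum \<open>u\<close> is then a
    limit point of each \<open>C i\<close> with \<open>P i u\<close>, because by \<open>lim\<close>
    the index \<open>i\<close> appears strictly before \<open>u\<close>.\<close>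
  have "\<exists>f. \<forall>n::nat. (f n \<in> D \<and> y0 \<le> f n) \<and>
      (f n < f (Suc n) \<and> (\<forall>i\<in>I. P i (f n) \<longrightarrow> (\<exists>c\<in>C i. f n < c \<and> c \<le> f (Suc n))))"
  proof (rule dependent_nat_choice)
    show "\<exists>x. x \<in> D \<and> y0 \<le> x" using y0 by blast
  next
    fix x assume x: "x \<in> D \<and> y0 \<le> x"
    with step obtain y' where "y' \<in> D" "x < y'" "\<forall>i\<in>I. P i x \<longrightarrow> (\<exists>c\<in>C i. x < c \<and> c \<le> y')"
      by blast
    then show "\<exists>y. (y \<in> D \<and> y0 \<le> y) \<and> x < y \<and> (\<forall>i\<in>I. P i x \<longrightarrow> (\<exists>c\<in>C i. x < c \<and> c \<le> y))"
      using x by (intro exI[of _ y']) auto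
  qed
  then obtain f where f: "\<forall>n::nat. f n \<in> D" "y0 \<le> f 0" "\<forall>n. f n < f (Suc n)"
    "\<forall>n. \<forall>i\<in>I. P i (f n) \<longrightarrow> (\<exists>c\<in>C i. f n < c \<and> c \<le> f (Suc n))" by blast
  obtain u where u: "u \<in> D" "is_limit u" "\<forall>n. f n < u" "\<forall>z<u. \<exists>n. z < f n"
    using uncountable_cof_sup[OF D f(1,3)] by blast
  have "u \<in> C i" if i: "i \<in> I" "P i u" for i
  proof (rule club_inD(3)[OF C[OF i(1)] u(1,2)], intro allI impI)
    fix z assume z: "z < u"
    obtain z' where z': "z' < u" "P i z'" using lim[OF i(2) u(2)] by blast
    obtain n where n: "max z z' < f n" using u(4) z z'(1) by (metis max_def)
    then have "P i (f n)" using mono[OF z'(2), of "f n"] n by (simp add: less_imp_le)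
    then obtain c where "c \<in> C i" "f n < c" "c \<le> f (Suc n)" using f(4) i(1) by blast
    then show "\<exists>c\<in>C i. z \<le> c \<and> c < u"
      using n u(3) by (intro bexI[of _ c]) (auto intro: le_less_trans)
  qed
  moreover have "y0 \<le> u" using f(2) u(3) by (meson le_less_trans less_imp_le)
  ultimately show "\<exists>c\<in>{y \<in> D. \<forall>i\<in>I. P i y \<longrightarrow> y \<in> C i}. y0 \<le> c" using u(1) by blast
next
  fix y assume y: "y \<in> D" "is_limit y"
    and cof: "\<forall>z<y. \<exists>c\<in>{y \<in> D. \<forall>i\<in>I. P i y \<longrightarrow> y \<in> C i}. z \<le> c \<and> c < y"
  have "y \<in> C i" if i: "i \<in> I" "P i y" for i
  proof (rule club_inD(3)[OF C[OF i(1)] y], intro allI impI)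
    fix z assume z: "z < y"
    obtain z' where z': "z' < y" "P i z'" using lim[OF i(2) y(2)] by blast
    have "max z z' < y" using z z'(1) by simp
    then obtain c where c: "\<forall>i\<in>I. P i c \<longrightarrow> c \<in> C i" "max z z' \<le> c" "c < y" using cof by blast
    then have "P i c" using mono[OF z'(2), of c] c(2) by simp
    then show "\<exists>c\<in>C i. z \<le> c \<and> c < y" using c i(1) by auto
  qed
  then show "y \<in> {y \<in> D. \<forall>i\<in>I. P i y \<longrightarrow> y \<in> C i}" using y(1) by blast
qed blast

lemma club_in_Int:
  assumes "down D" "uncountable_cof D" "club_in D C" "club_in D C'"
  shows "club_in D (C \<inter> C')"
proof -
  have "club_in D {y \<in> D. \<forall>i\<in>UNIV. True \<longrightarrow> y \<in> (if i then C else C')}"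
  proof (rule club_in_diagonal[OF assms(1,2)])
    show "\<exists>z<u. True" if "is_limit u" for u :: 'a using that by (auto simp: is_limit_def)
    fix y and g :: "bool \<Rightarrow> 'a" assume "\<forall>i\<in>UNIV. True \<longrightarrow> g i \<in> D"
    then show "\<exists>b\<in>D. \<forall>i\<in>UNIV. True \<longrightarrow> g i \<le> b"
      by (intro bexI[of _ "max (g True) (g False)"])
        (auto simp: max_def all_bool_eq UNIV_bool)
  qed (use assms in auto)
  moreover have "{y \<in> D. \<forall>i\<in>UNIV. True \<longrightarrow> y \<in> (if i then C else C')} = C \<inter> C'"
    using club_inD(1)[OF assms(3)] by (auto simp: all_bool_eq UNIV_bool)
  ultimately show ?thesis by simp
qed

lemma club_in_tail:
  assumes "uncountable_cof D" "b \<in> D" shows "club_in D {y \<in> D. b < y}"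
proof (rule club_inI)
  fix y assume "y \<in> D"
  then have "max y b \<in> D" using assms by (simp add: max_def)
  then show "\<exists>c\<in>{y \<in> D. b < y}. y \<le> c" using uncountable_cof_gt[OF assms(1)] by fastforce
next
  fix y assume y: "y \<in> D" "is_limit y" "\<forall>z<y. \<exists>c\<in>{y \<in> D. b < y}. z \<le> c \<and> c < y"
  obtain z where "z < y" using y(2) by (auto simp: is_limit_def)
  then show "y \<in> {y \<in> D. b < y}" using y by fastforce
qed blast

text \<open>Cofinality of the set of limit points comes from suprema of \<omega>-sequences in
  \<open>R\<close>, which stay inside \<open>D\<close> by uncountable cofinality.\<close>

lemma club_in_limits:
  assumes D: "down D" "uncountable_cof D" and R: "cofinal_in (R \<inter> D) D"
  shows "club_in D {y \<in> D. is_limit y \<and> cofinal_in (R \<inter> oseg y) (oseg y)}"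
proof (rule club_inI)
  fix y0 assume y0: "y0 \<in> D"
  have step: "\<exists>y. y \<in> R \<inter> D \<and> x < y" if x: "x \<in> D" for x
    using uncountable_cof_gt[OF D(2) x] R unfolding cofinal_in_def by (meson less_le_trans)
  have "\<exists>f. \<forall>n::nat. (f n \<in> R \<inter> D \<and> y0 < f n) \<and> f n < f (Suc n)"
  proof (rule dependent_nat_choice)
    show "\<exists>x. x \<in> R \<inter> D \<and> y0 < x" using step[OF y0] .
  next
    fix x assume x: "x \<in> R \<inter> D \<and> y0 < x"
    then obtain y where "y \<in> R \<inter> D" "x < y" using step by blast
    then show "\<exists>y. (y \<in> R \<inter> D \<and> y0 < y) \<and> x < y" using x by (meson less_trans)
  qed
  then obtain f where f: "\<forall>n::nat. f n \<in> R" "\<forall>n. f n \<in> D" "\<forall>n. y0 < f n" "\<forall>n. f n < f (Suc n)"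
    by blast
  obtain u where u: "u \<in> D" "is_limit u" "\<forall>n. f n < u" "\<forall>z<u. \<exists>n. z < f n"
    using uncountable_cof_sup[OF D f(2,4)] by blast
  have "cofinal_in (R \<inter> oseg u) (oseg u)"
    unfolding cofinal_in_Int_oseg using u(3,4) f(1) less_imp_le by blast
  moreover have "y0 \<le> u" using f(3) u(3) by (meson less_trans less_imp_le)
  ultimately show "\<exists>c\<in>{y \<in> D. is_limit y \<and> cofinal_in (R \<inter> oseg y) (oseg y)}. y0 \<le> c"
    using u by blast
next
  fix y assume y: "y \<in> D" "is_limit y"
    and cof: "\<forall>z<y. \<exists>c\<in>{y \<in> D. is_limit y \<and> cofinal_in (R \<inter> oseg y) (oseg y)}. z \<le> c \<and> c < y"
  have "\<exists>r\<in>R. z \<le> r \<and> r < y" if z: "z < y" for z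
  proof -
    obtain z' where z': "z < z'" "z' < y" using y(2) z by (auto simp: is_limit_def)
    then obtain c where c: "cofinal_in (R \<inter> oseg c) (oseg c)" "z' \<le> c" "c < y" using cof by blast
    then have "z < c" using z' by simp
    then obtain r where "r \<in> R" "z \<le> r" "r < c" using c(1) unfolding cofinal_in_Int_oseg by blast
    then show ?thesis using c(3) by (meson less_trans)
  qed
  then show "y \<in> {y \<in> D. is_limit y \<and> cofinal_in (R \<inter> oseg y) (oseg y)}"
    using y by (simp add: cofinal_in_Int_oseg)
qed blast

section \<open>Nonstationary and nowhere stationary sets as ideals\<close>

lemma nonstationary_in_subset:
  "\<lbrakk>nonstationary_in D Y; X \<subseteq> Y\<rbrakk> \<Longrightarrow> nonstationary_in D X"
  unfolding nonstationary_in_def by blast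

lemma nonstationary_in_Un:
  assumes "down D" "uncountable_cof D" "nonstationary_in D X" "nonstationary_in D Y"
  shows "nonstationary_in D (X \<union> Y)"
proof -
  obtain C C' where "club_in D C" "C \<inter> X = {}" "club_in D C'" "C' \<inter> Y = {}"
    using assms(3,4) unfolding nonstationary_in_def by blast
  then show ?thesis unfolding nonstationary_in_def
    using club_in_Int[OF assms(1,2)] by (intro exI[of _ "C \<inter> C'"]) blast
qed

lemma nowhere_stationary_subset:
  assumes "nowhere_stationary D Y" "X \<subseteq> Y" shows "nowhere_stationary D X"
  unfolding nowhere_stationary_def
proof (intro conjI ballI impI)
  show "X \<subseteq> D" using assms unfolding nowhere_stationary_def by blast
  fix D' assume "D' \<in> insert D (oseg ` D)" "uncountable_cof D'"
  then have "nonstationary_in D' (Y \<inter> D')" using assms(1) unfolding nowhere_stationary_def by blast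
  then show "nonstationary_in D' (X \<inter> D')" using assms(2) by (blast intro: nonstationary_in_subset)
qed

lemma nowhere_stationary_Un:
  assumes "down D" "nowhere_stationary D X" "nowhere_stationary D Y"
  shows "nowhere_stationary D (X \<union> Y)"
  unfolding nowhere_stationary_def
proof (intro conjI ballI impI)
  show "X \<union> Y \<subseteq> D" using assms unfolding nowhere_stationary_def by blast
  fix D' assume D': "D' \<in> insert D (oseg ` D)" "uncountable_cof D'"
  then have "nonstationary_in D' (X \<inter> D')" "nonstationary_in D' (Y \<inter> D')"
    using assms unfolding nowhere_stationary_def by blast+
  moreover have "down D'" using D'(1) assms(1) by auto
  ultimately show "nonstationary_in D' ((X \<union> Y) \<inter> D')"
    using nonstationary_in_Un[OF _ D'(2)] by (simp add: Int_Un_distrib2)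
qed

text \<open>Strong inaccessibility in a form that also applies to \<open>UNIV\<close>, that is, to
  \<kappa> itself. Being a cardinal follows from the power set clause by Cantor's theorem.\<close>

definition inaccessible_in :: "'k::wellorder set \<Rightarrow> bool" where
  "inaccessible_in D \<longleftrightarrow> \<not> countable D \<and> (\<forall>C. cofinal_in C D \<longrightarrow> C \<approx> D) \<and> (\<forall>b\<in>D. Pow (oseg b) \<prec> D)"

lemma strongly_inaccessible_iff: "strongly_inaccessible a \<longleftrightarrow> inaccessible_in (oseg a)"
proof -
  have "oseg b \<prec> oseg a" if "Pow (oseg b) \<prec> oseg a" for b
    using lesspoll_trans[OF lesspoll_Pow_self that] .
  then show ?thesis unfolding strongly_inaccessible_def inaccessible_in_def Ball_def mem_oseg by blast
qed

lemma inaccessible_in_uncountable_cof: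
  assumes "inaccessible_in D" shows "uncountable_cof D"
  unfolding uncountable_cof_def
proof (intro allI impI)
  fix C assume "cofinal_in C D"
  then have "D \<approx> C" using assms eqpoll_sym unfolding inaccessible_in_def by blast
  then show "\<not> countable C" using assms countable_eqpoll unfolding inaccessible_in_def by blast
qed

lemma inaccessible_in_infinite: "inaccessible_in D \<Longrightarrow> infinite D"
  unfolding inaccessible_in_def using countable_finite by blast

text \<open>By regularity the image of \<open>A\<close> is too small to be cofinal.\<close>

lemma inaccessible_in_bound:
  assumes "inaccessible_in D" "A \<prec> D" "\<forall>a\<in>A. g a \<in> D"
  shows "\<exists>b\<in>D. \<forall>a\<in>A. g a < b"
proof -
  have "\<not> cofinal_in (g ` A) D"
  proof
    assume "cofinal_in (g ` A) D"
    then have "D \<lesssim> g ` A"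
      using assms(1) unfolding inaccessible_in_def by (blast intro: eqpoll_sym eqpoll_imp_lepoll)
    also have "g ` A \<lesssim> A" by (rule image_lepoll)
    also note assms(2)
    finally show False by simp
  qed
  then show ?thesis using assms(3) by (auto simp: cofinal_in_def not_le)
qed

lemma strongly_inaccessible_limit:
  assumes "strongly_inaccessible d" shows "is_limit d"
proof -
  have u: "uncountable_cof (oseg d)"
    using assms by (simp add: strongly_inaccessible_iff inaccessible_in_uncountable_cof)
  have "oseg d \<noteq> {}" using assms unfolding strongly_inaccessible_def by auto
  then show ?thesis using uncountable_cof_gt[OF u] unfolding is_limit_def
    by (metis all_not_in_conv mem_oseg)
qed

section \<open>Counting nodes below an inaccessible\<close>

lemma nodes_upto_lepoll: "{\<eta> \<in> nodes UNIV. fst \<eta> \<le> (y::'k::wellorder)} \<lesssim> Pow {..y}"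
proof -
  \<comment> \<open>The support of a node lies strictly below its length, so the length is recovered
    as the greatest element of the code.\<close>
  define h where "h \<eta> = insert (fst \<eta>) {x. snd \<eta> x}" for \<eta> :: "'k node"
  have zero: "snd \<eta> x \<Longrightarrow> x < fst \<eta>" if "\<eta> \<in> nodes UNIV" for \<eta> :: "'k node" and x
    using that by (auto simp: nodes_def not_less[symmetric])
  have "inj_on h (nodes UNIV)"
  proof (rule inj_onI)
    fix \<eta> \<nu> :: "'k node" assume n: "\<eta> \<in> nodes UNIV" "\<nu> \<in> nodes UNIV" "h \<eta> = h \<nu>"
    have "fst \<eta> \<in> h \<nu>" "fst \<nu> \<in> h \<eta>" using n(3) by (auto simp: h_def)
    then have f: "fst \<eta> = fst \<nu>" using zero[OF n(1)] zero[OF n(2)] by (force simp: h_def)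
    have "snd \<eta> x = snd \<nu> x" for x
    proof (cases "x = fst \<eta>")
      case True
      then show ?thesis using zero[OF n(1), of x] zero[OF n(2), of x] f by auto
    next
      case False
      then have "x \<in> h \<eta> \<longleftrightarrow> snd \<eta> x" "x \<in> h \<nu> \<longleftrightarrow> snd \<nu> x" using f by (auto simp: h_def)
      then show ?thesis using n(3) by simp
    qed
    then show "\<eta> = \<nu>" using f by (simp add: prod_eq_iff ext)
  qed
  moreover have "h ` {\<eta> \<in> nodes UNIV. fst \<eta> \<le> y} \<subseteq> Pow {..y}"
    using zero by (fastforce simp: h_def)
  ultimately show ?thesis unfolding lepoll_def by (metis (no_types, lifting) inj_on_subset mem_Collect_eq subsetI)
qed

lemma nodes_upto_lesspoll:
  assumes "inaccessible_in D" "down D" "y \<in> D"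
  shows "{\<eta> \<in> nodes UNIV. fst \<eta> \<le> y} \<prec> D"
proof -
  obtain z where z: "z \<in> D" "y < z"
    using uncountable_cof_gt[OF inaccessible_in_uncountable_cof] assms by blast
  have "Pow {..y} \<subseteq> Pow (oseg z)" using z(2) by auto
  then have "{\<eta> \<in> nodes UNIV. fst \<eta> \<le> y} \<lesssim> Pow (oseg z)"
    by (rule lepoll_trans[OF nodes_upto_lepoll subset_imp_lepoll])
  moreover have "Pow (oseg z) \<prec> D" using assms(1) z(1) unfolding inaccessible_in_def by blast
  ultimately show ?thesis by (rule lesspoll_trans1)
qed

lemma nodes_lepoll:
  assumes "inaccessible_in D" "down D" shows "nodes D \<lesssim> D"
proof -
  have "nodes D \<subseteq> (\<Union>y\<in>D. {\<eta> \<in> nodes UNIV. fst \<eta> \<le> y})" by (auto simp: nodes_def)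
  moreover have "(\<Union>y\<in>D. {\<eta> \<in> nodes UNIV. fst \<eta> \<le> y}) \<lesssim> D"
    by (intro UN_lepoll_infinite[OF inaccessible_in_infinite[OF assms(1)] lepoll_refl]
      lesspoll_imp_lepoll nodes_upto_lesspoll[OF assms])
  ultimately show ?thesis by (rule lepoll_trans[OF subset_imp_lepoll])
qed

text \<open>The reason: \<open>a\<close> is the union of the segments below the points of \<open>C\<close>.\<close>
lemma small_cofinal:
  assumes "infinite C" "cofinal_in C (oseg a)" "C \<prec> oseg a"
  shows "\<exists>b<a. \<not> oseg b \<lesssim> C"
proof (rule ccontr)
  assume "\<not> ?thesis"
  then have le: "oseg b \<lesssim> C" if "b < a" for b using that by blast
  have "insert c (oseg c) \<lesssim> C" if "c \<in> C" for c
  proof (cases "finite (oseg c)")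
    case True
    then have "finite (insert c (oseg c))" by simp
    then show ?thesis by (rule finite_lepoll_infinite[OF assms(1)])
  next
    case False
    have "c < a" using that assms(2) by (auto simp: cofinal_in_def)
    then show ?thesis using lepoll_trans[OF infinite_insert_lepoll[OF False] le] by blast
  qed
  then have "(\<Union>c\<in>C. insert c (oseg c)) \<lesssim> C"
    by (rule UN_lepoll_infinite[OF assms(1) lepoll_refl])
  moreover have "x \<in> (\<Union>c\<in>C. insert c (oseg c))" if x: "x < a" for x
  proof -
    obtain c where "c \<in> C" "x \<le> c" using cofinal_inD[OF assms(2), of x] x by auto
    then show ?thesis by (intro UN_I[of c]) (auto simp: le_less)
  qed
  then have "oseg a \<lesssim> (\<Union>c\<in>C. insert c (oseg c))" by (intro subset_imp_lepoll subsetI) simp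
  ultimately have "oseg a \<lesssim> C" using lepoll_trans by blast
  then show False using lesspoll_trans1[OF _ assms(3)] by blast
qed

text \<open>If \<open>a\<close> is not a strong limit, witnessed by \<open>b\<close>, every point
  above \<open>b\<close> fails for the same reason. Otherwise \<open>a\<close> has a short cofinal
  set \<open>C\<close>, and some \<open>b\<close> below \<open>a\<close> does not embed in
  \<open>C\<close>. A limit point \<open>y\<close> of \<open>C\<close> above \<open>b\<close> then
  has a cofinal subset too small for \<open>y\<close>.\<close>

lemma club_of_non_inaccessibles:
  assumes u: "uncountable_cof (oseg a)" and ni: "\<not> strongly_inaccessible a"
  shows "\<exists>C. club_in (oseg a) C \<and> (\<forall>y\<in>C. \<not> strongly_inaccessible y)"
proof (cases "\<forall>b<a. Pow (oseg b) \<prec> oseg a")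
  case False
  then obtain b where b: "b < a" "\<not> Pow (oseg b) \<prec> oseg a" by blast
  have "\<not> strongly_inaccessible y" if y: "b < y" "y < a" for y
  proof
    assume "strongly_inaccessible y"
    then have "Pow (oseg b) \<prec> oseg y" using y(1) unfolding strongly_inaccessible_def by blast
    moreover have "oseg y \<lesssim> oseg a" using y(2) by (intro subset_imp_lepoll oseg_subset) simp
    ultimately show False using b(2) lesspoll_trans2 by blast
  qed
  then show ?thesis using club_in_tail[OF u, of b] b(1) by (intro exI[of _ "{y \<in> oseg a. b < y}"]) auto
next
  case True
  have "cofinal_in (oseg a) (oseg a)" by (auto simp: cofinal_in_def)
  then have "\<not> countable (oseg a)" using u unfolding uncountable_cof_def by blast
  then obtain C where C: "cofinal_in C (oseg a)" "\<not> C \<approx> oseg a"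
    using ni True unfolding strongly_inaccessible_iff inaccessible_in_def by auto
  then have "C \<prec> oseg a" unfolding lesspoll_def cofinal_in_def by (simp add: subset_imp_lepoll)
  moreover have "infinite C" using C(1) u countable_finite unfolding uncountable_cof_def by blast
  ultimately obtain b where b: "b < a" "\<not> oseg b \<lesssim> C" using small_cofinal C(1) by blast
  have "C \<inter> oseg a = C" using C(1) by (auto simp: cofinal_in_def)
  then have "club_in (oseg a) ({y \<in> oseg a. is_limit y \<and> cofinal_in (C \<inter> oseg y) (oseg y)} \<inter> {y \<in> oseg a. b < y})"
    (is "club_in _ ?E")
    using club_in_Int[OF down_oseg u club_in_limits[OF down_oseg u] club_in_tail[OF u]] C(1) b(1) by simp
  moreover have "\<not> strongly_inaccessible y" if y: "y \<in> ?E" for y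
  proof
    assume "strongly_inaccessible y"
    then have "C \<inter> oseg y \<approx> oseg y" using y unfolding strongly_inaccessible_def by blast
    then have "oseg y \<lesssim> C \<inter> oseg y" by (simp add: eqpoll_sym eqpoll_imp_lepoll)
    moreover have "oseg b \<lesssim> oseg y" using y by (intro subset_imp_lepoll oseg_subset) auto
    moreover have "C \<inter> oseg y \<lesssim> C" by (intro subset_imp_lepoll) simp
    ultimately show False using b(2) lepoll_trans[of "oseg b" "oseg y" C] lepoll_trans[of "oseg y" "C \<inter> oseg y" C] by blast
  qed
  ultimately show ?thesis by blast
qed

text \<open>A set of inaccessibles can only be stationary in an inaccessible \<open>D\<close>. There
  fewer than \<open>D\<close> many indices are active below any given point, so the diagonal
  intersection of the clubs avoiding the \<open>S i\<close> is a club. It serves for the gap levels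
  of \<kappa> many conditions, each counted only above its trunk.\<close>

lemma nowhere_stationary_diagonal:
  fixes S :: "'i \<Rightarrow> 'k::wellorder set" and l :: "'i \<Rightarrow> 'k"
  assumes U: "inaccessible_in (UNIV::'k set)"
    and S: "\<And>i. i \<in> I \<Longrightarrow> S i \<subseteq> S_inc UNIV" "\<And>i. i \<in> I \<Longrightarrow> nowhere_stationary UNIV (S i)"
    and small: "\<And>D y. \<lbrakk>down D; inaccessible_in D; y \<in> D\<rbrakk> \<Longrightarrow> {i \<in> I. l i < y} \<prec> D"
  shows "nowhere_stationary UNIV {d. \<exists>i\<in>I. l i < d \<and> d \<in> S i}" (is "nowhere_stationary _ ?S")
  unfolding nowhere_stationary_def
proof (intro conjI ballI impI)
  fix D :: "'k set" assume D: "D \<in> insert UNIV (range oseg)" "uncountable_cof D"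
  then have dD: "down D" by auto
  show "nonstationary_in D (?S \<inter> D)"
  proof (cases "inaccessible_in D")
    case False
    then obtain a where a: "D = oseg a" "\<not> strongly_inaccessible a"
      using D(1) U by (auto simp: strongly_inaccessible_iff)
    then obtain C where C: "club_in D C" "\<forall>y\<in>C. \<not> strongly_inaccessible y"
      using club_of_non_inaccessibles D(2) by blast
    then have "C \<inter> (?S \<inter> D) = {}" using S(1) by (auto simp: S_inc_def)
    then show ?thesis using C(1) unfolding nonstationary_in_def by blast
  next
    case True
    have "\<forall>i\<in>I. \<exists>C. club_in D C \<and> C \<inter> (S i \<inter> D) = {}"
      using S(2) D unfolding nowhere_stationary_def nonstationary_in_def by blast
    from bchoice[OF this] obtain C where C: "\<forall>i\<in>I. club_in D (C i) \<and> C i \<inter> (S i \<inter> D) = {}" by blast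
    have "club_in D {y \<in> D. \<forall>i\<in>I. l i < y \<longrightarrow> y \<in> C i}"
    proof (rule club_in_diagonal[OF dD D(2)])
      fix i u assume "l i < u" "is_limit u"
      then show "\<exists>z<u. l i < z" by (auto simp: is_limit_def)
    next
      fix y g assume y: "y \<in> D" "\<forall>i\<in>I. l i < y \<longrightarrow> g i \<in> D"
      then have "\<exists>b\<in>D. \<forall>i\<in>{i\<in>I. l i < y}. g i < b"
        by (intro inaccessible_in_bound[OF True small[OF dD True y(1)]]) auto
      then show "\<exists>b\<in>D. \<forall>i\<in>I. l i < y \<longrightarrow> g i \<le> b" using less_imp_le by blast
    qed (use C in auto)
    moreover have "{y \<in> D. \<forall>i\<in>I. l i < y \<longrightarrow> y \<in> C i} \<inter> (?S \<inter> D) = {}" using C by blast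
    ultimately show ?thesis unfolding nonstationary_in_def by blast
  qed
qed simp

text \<open>Where \<open>R\<close> is unbounded, the club of its limit points misses the set; where
  \<open>R\<close> is bounded, a tail does.\<close>

lemma nowhere_stationary_discrete:
  "nowhere_stationary UNIV {d \<in> R. \<not> cofinal_in (R \<inter> oseg d) (oseg d)}" (is "nowhere_stationary _ ?S")
  unfolding nowhere_stationary_def
proof (intro conjI ballI impI)
  fix D :: "'a set" assume D: "D \<in> insert UNIV (range oseg)" "uncountable_cof D"
  then have dD: "down D" by auto
  show "nonstationary_in D (?S \<inter> D)"
  proof (cases "cofinal_in (R \<inter> D) D")
    case True
    then show ?thesis using club_in_limits[OF dD D(2)] unfolding nonstationary_in_def by blast
  next
    case False
    then obtain b where b: "b \<in> D" "\<forall>c\<in>R \<inter> D. c < b" by (auto simp: cofinal_in_def not_le)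
    then have "{y \<in> D. b < y} \<inter> (?S \<inter> D) = {}" by (blast dest: less_asym)
    then show ?thesis using club_in_tail[OF D(2) b(1)] unfolding nonstationary_in_def by blast
  qed
qed simp

section \<open>Conditions and compatibility\<close>

lemma fst_restr [simp]: "fst (restr x s) = s"
  and snd_restr: "snd (restr x s) = (\<lambda>y. y < s \<and> x y)"
  by (auto simp: restr_def)

lemma restr_in_nodes: "s \<in> D \<Longrightarrow> restr x s \<in> nodes D"
  by (auto simp: nodes_def snd_restr)

lemma snd_restr_funs: "snd (restr x s) \<in> funs (oseg s)"
  by (auto simp: funs_def snd_restr)

lemma restr_restr: "s \<le> t \<Longrightarrow> restr (snd (restr x t)) s = restr x s"
  by (auto simp: restr_def)

lemma fun_node: "d \<in> D \<Longrightarrow> x \<in> funs (oseg d) \<Longrightarrow> (d, x) \<in> nodes D"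
  by (auto simp: nodes_def funs_def)

lemma node_fun: "\<eta> \<in> nodes D \<Longrightarrow> snd \<eta> \<in> funs (oseg (fst \<eta>))"
  by (auto simp: nodes_def funs_def not_less)

lemma restr_eq_fun: "x \<in> funs (oseg d) \<Longrightarrow> restr x d = (d, x)"
  by (auto simp: funs_def restr_def)

lemma nodes_mono: "D \<subseteq> E \<Longrightarrow> nodes D \<subseteq> nodes E"
  by (auto simp: nodes_def)

lemma nodesD: "\<eta> \<in> nodes D \<Longrightarrow> fst \<eta> \<in> D"
  by (auto simp: nodes_def)

lemma initseg_refl [simp]: "initseg \<eta> \<eta>"
  by (simp add: initseg_def)

lemma initseg_trans: "\<lbrakk>initseg \<eta> \<nu>; initseg \<nu> \<rho>\<rbrakk> \<Longrightarrow> initseg \<eta> \<rho>"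
  by (auto simp: initseg_def)

lemma initseg_restr:
  assumes "initseg \<eta> \<nu>" "\<eta> \<in> nodes D" shows "\<eta> = restr (snd \<nu>) (fst \<eta>)"
  using assms by (auto simp: nodes_def initseg_def restr_def prod_eq_iff fun_eq_iff not_less)

lemma restr_initseg: "s \<le> fst \<eta> \<Longrightarrow> initseg (restr (snd \<eta>) s) \<eta>"
  by (auto simp: initseg_def snd_restr)

lemma initseg_comparable:
  assumes "initseg \<eta> \<rho>" "initseg \<nu> \<rho>" "fst \<eta> \<le> fst \<nu>" shows "initseg \<eta> \<nu>"
  unfolding initseg_def
proof (intro conjI allI impI assms(3))
  fix y assume "y < fst \<eta>"
  then have "y < fst \<eta>" "y < fst \<nu>" using assms(3) by auto
  then show "snd \<eta> y = snd \<nu> y" using assms(1,2) by (simp add: initseg_def)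
qed

text \<open>The level of \<open>extn\<close> is the successor of \<open>fst \<eta>\<close>. The
  larger point \<open>z\<close> is needed for the \<open>LEAST\<close> in \<open>extn\<close> to be
  meaningful.\<close>

lemma less_fst_extn:
  assumes "fst \<eta> < z" shows "y < fst (extn \<eta> b) \<longleftrightarrow> y \<le> fst \<eta>"
proof -
  have "fst \<eta> < (LEAST z. fst \<eta> < z)" using assms by (rule LeastI)
  moreover have "\<not> fst \<eta> < y" if "y < (LEAST z. fst \<eta> < z)" using that by (rule not_less_Least)
  ultimately show ?thesis unfolding extn_def using le_less_trans by auto
qed

lemma fst_extn: "fst (extn \<eta> b) = (LEAST z. fst \<eta> < z)"
  by (simp add: extn_def)

lemma extn_restr:
  assumes "m < z" shows "extn (restr x m) (x m) = restr x (LEAST z. m < z)"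
proof -
  define k where "k = (LEAST z. m < z)"
  have k: "y < k \<longleftrightarrow> y \<le> m" for y
    using less_fst_extn[of "restr x m" z y] assms unfolding k_def by (simp add: fst_extn)
  have "((snd (restr x m))(m := x m)) y = snd (restr x k) y" for y
    unfolding snd_restr k by (simp add: le_less)
  then show ?thesis unfolding k_def extn_def by (simp add: prod_eq_iff ext)
qed

section \<open>Conditions described by trees, trunks and gaps\<close>

definition tree :: "'k::wellorder set \<Rightarrow> 'k node set \<Rightarrow> bool" where
  "tree D p \<longleftrightarrow> p \<subseteq> nodes D \<and> (\<forall>\<eta>\<in>p. \<forall>s\<le>fst \<eta>. restr (snd \<eta>) s \<in> p)"

text \<open>That \<open>\<tau>\<close> itself splits is the instance \<open>\<eta> = \<tau>\<close>
  of the last clause.\<close>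

definition trunk :: "'k::wellorder node set \<Rightarrow> 'k node \<Rightarrow> bool" where
  "trunk p \<tau> \<longleftrightarrow> \<tau> \<in> p \<and>
     (\<forall>\<nu>\<in>p. extn \<nu> False \<in> p \<and> extn \<nu> True \<in> p \<longrightarrow> initseg \<tau> \<nu>) \<and>
     (\<forall>\<eta>\<in>p. initseg \<tau> \<eta> \<longrightarrow> extn \<eta> False \<in> p \<and> extn \<eta> True \<in> p)"

lemma trunk_mem: "trunk p \<tau> \<Longrightarrow> \<tau> \<in> p"
  unfolding trunk_def by (rule conjunct1)

lemma trunk_least:
  assumes "trunk p \<tau>" "\<nu> \<in> p" "extn \<nu> False \<in> p" "extn \<nu> True \<in> p"
  shows "initseg \<tau> \<nu>"
proof -
  have "\<forall>\<nu>\<in>p. extn \<nu> False \<in> p \<and> extn \<nu> True \<in> p \<longrightarrow> initseg \<tau> \<nu>"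
    using assms(1) unfolding trunk_def by (elim conjE)
  from mp[OF bspec[OF this assms(2)] conjI[OF assms(3,4)]] show ?thesis .
qed

lemma trunk_extn:
  assumes "trunk p \<tau>" "\<eta> \<in> p" "initseg \<tau> \<eta>"
  shows "extn \<eta> b \<in> p"
proof -
  have "\<forall>\<eta>\<in>p. initseg \<tau> \<eta> \<longrightarrow> extn \<eta> False \<in> p \<and> extn \<eta> True \<in> p"
    using assms(1) unfolding trunk_def by (elim conjE)
  from mp[OF bspec[OF this assms(2)] assms(3)] show ?thesis by (cases b) simp_all
qed

lemma trunkI:
  assumes "\<tau> \<in> p" "\<And>\<nu>. \<lbrakk>\<nu> \<in> p; extn \<nu> False \<in> p; extn \<nu> True \<in> p\<rbrakk> \<Longrightarrow> initseg \<tau> \<nu>"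
    "\<And>\<eta> b. \<lbrakk>\<eta> \<in> p; initseg \<tau> \<eta>\<rbrakk> \<Longrightarrow> extn \<eta> b \<in> p"
  shows "trunk p \<tau>"
  unfolding trunk_def using assms by (intro conjI ballI impI) (elim conjE, assumption | rule assms; assumption)+

definition gap :: "'k::wellorder node set \<Rightarrow> 'k \<Rightarrow> ('k \<Rightarrow> bool) set" where
  "gap p d = {x \<in> funs (oseg d). (\<forall>s<d. restr x s \<in> p) \<and> (d, x) \<notin> p}"

definition gaps :: "'k::wellorder set \<Rightarrow> 'k node set \<Rightarrow> 'k set" where
  "gaps D p = {d \<in> D. is_limit d \<and> gap p d \<noteq> {}}"

text \<open>A condition determines the least possible witness: the levels where it has a gap, and
  the gaps themselves.\<close>
definition cond :: "'k::wellorder set \<Rightarrow> 'k node set \<Rightarrow> bool" where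
  "cond D p \<longleftrightarrow> tree D p \<and> (\<exists>\<tau>. trunk p \<tau>) \<and> gaps D p \<subseteq> S_inc D \<and>
     nowhere_stationary D (gaps D p) \<and> (\<forall>d\<in>gaps D p. gap p d \<in> idQ d)"

text \<open>The clauses of \<open>Qset\<close> that do not mention the ideals. The dependence on
  \<open>I\<close> is thereby isolated in the single requirement on \<open>N\<close>.\<close>

definition witness :: "'k::wellorder set \<Rightarrow> 'k node set \<Rightarrow> 'k set \<Rightarrow> ('k \<Rightarrow> ('k \<Rightarrow> bool) set) \<Rightarrow> bool" where
  "witness D p S N \<longleftrightarrow> tree D p \<and> (\<exists>\<tau>. trunk p \<tau>) \<and> S \<subseteq> S_inc D \<and> nowhere_stationary D S \<and>
     (\<forall>d\<in>D. is_limit d \<and> d \<notin> S \<longrightarrow>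
        (\<forall>\<eta>\<in>nodes D. fst \<eta> = d \<longrightarrow> (\<eta> \<in> p \<longleftrightarrow> (\<forall>s<d. restr (snd \<eta>) s \<in> p)))) \<and>
     (\<forall>d\<in>S. \<forall>\<eta>\<in>nodes D. fst \<eta> = d \<longrightarrow>
        (\<eta> \<in> p \<longleftrightarrow> (\<forall>s<d. restr (snd \<eta>) s \<in> p) \<and> snd \<eta> \<notin> N d))"

lemma Qset_iff_witness: "p \<in> Qset D I \<longleftrightarrow> (\<exists>S N. witness D p S N \<and> (\<forall>d\<in>S. N d \<in> I d))"
proof
  assume "p \<in> Qset D I"
  then show "\<exists>S N. witness D p S N \<and> (\<forall>d\<in>S. N d \<in> I d)"
    unfolding Qset_def mem_Collect_eq
  proof (elim conjE exE)
    fix \<tau> S N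
    assume *: "p \<subseteq> nodes D" "\<forall>\<eta>\<in>p. \<forall>s\<le>fst \<eta>. restr (snd \<eta>) s \<in> p"
      "\<tau> \<in> p" "\<forall>\<nu>\<in>p. extn \<nu> False \<in> p \<and> extn \<nu> True \<in> p \<longrightarrow> initseg \<tau> \<nu>"
      "\<forall>\<eta>\<in>p. initseg \<tau> \<eta> \<longrightarrow> extn \<eta> False \<in> p \<and> extn \<eta> True \<in> p"
      and **: "S \<subseteq> S_inc D" "nowhere_stationary D S" "\<forall>d\<in>S. N d \<in> I d"
      "\<forall>d\<in>D. is_limit d \<and> d \<notin> S \<longrightarrow>
           (\<forall>\<eta>\<in>nodes D. fst \<eta> = d \<longrightarrow> (\<eta> \<in> p \<longleftrightarrow> (\<forall>s<d. restr (snd \<eta>) s \<in> p)))"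
      "\<forall>d\<in>S. \<forall>\<eta>\<in>nodes D. fst \<eta> = d \<longrightarrow>
           (\<eta> \<in> p \<longleftrightarrow> (\<forall>s<d. restr (snd \<eta>) s \<in> p) \<and> snd \<eta> \<notin> N d)"
    have "tree D p" unfolding tree_def using *(1,2) by (intro conjI)
    moreover have "trunk p \<tau>" unfolding trunk_def using *(3-5) by (intro conjI)
    then have "\<exists>\<tau>. trunk p \<tau>" ..
    ultimately have "witness D p S N" unfolding witness_def using **(1,2,4,5) by (intro conjI)
    then show ?thesis using **(3) by (intro exI conjI)
  qed
next
  assume "\<exists>S N. witness D p S N \<and> (\<forall>d\<in>S. N d \<in> I d)"
  then obtain S N \<tau> where *: "witness D p S N" "\<forall>d\<in>S. N d \<in> I d" "trunk p \<tau>"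
    unfolding witness_def by blast
  have "extn \<tau> False \<in> p" "extn \<tau> True \<in> p"
    using trunk_extn[OF *(3) trunk_mem[OF *(3)] initseg_refl] by blast+
  moreover have "p \<subseteq> nodes D" "\<forall>\<eta>\<in>p. \<forall>s\<le>fst \<eta>. restr (snd \<eta>) s \<in> p"
    using *(1) unfolding witness_def tree_def by - (elim conjE, assumption)+
  moreover have "\<tau> \<in> p" "\<forall>\<nu>\<in>p. extn \<nu> False \<in> p \<and> extn \<nu> True \<in> p \<longrightarrow> initseg \<tau> \<nu>"
    "\<forall>\<eta>\<in>p. initseg \<tau> \<eta> \<longrightarrow> extn \<eta> False \<in> p \<and> extn \<eta> True \<in> p"
    using *(3) unfolding trunk_def by - (elim conjE, assumption)+
  moreover note *(2)
  moreover have "S \<subseteq> S_inc D" "nowhere_stationary D S"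
    "\<forall>d\<in>D. is_limit d \<and> d \<notin> S \<longrightarrow>
        (\<forall>\<eta>\<in>nodes D. fst \<eta> = d \<longrightarrow> (\<eta> \<in> p \<longleftrightarrow> (\<forall>s<d. restr (snd \<eta>) s \<in> p)))"
    "\<forall>d\<in>S. \<forall>\<eta>\<in>nodes D. fst \<eta> = d \<longrightarrow>
        (\<eta> \<in> p \<longleftrightarrow> (\<forall>s<d. restr (snd \<eta>) s \<in> p) \<and> snd \<eta> \<notin> N d)"
    using *(1) unfolding witness_def by - (elim conjE, assumption)+
  ultimately show "p \<in> Qset D I" unfolding Qset_def
    by (intro CollectI conjI exI[of _ \<tau>] exI[of _ S] exI[of _ N])
qed

text \<open>The levels of a witness lie in \<open>D\<close>, so only the values of \<open>I\<close>
  on \<open>D\<close> are consulted. This is what lets the recursion for \<open>idQ\<close>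
  unfold.\<close>

lemma Qset_cong:
  assumes "\<And>d. d \<in> D \<Longrightarrow> I d = I' d" shows "Qset D I = Qset D I'"
proof -
  have "(\<forall>d\<in>S. N d \<in> I d) \<longleftrightarrow> (\<forall>d\<in>S. N d \<in> I' d)" if "witness D p S N" for p S N
    using that assms unfolding witness_def S_inc_def by blast
  then show ?thesis unfolding set_eq_iff Qset_iff_witness by blast
qed

lemma idQ_unfold: "idQ d = idset (oseg d) idQ"
proof -
  have "wf {(x, y). x < (y::'a)}" by (rule wf)
  then have "idQ d = idset (oseg d) (cut idQ {(x, y). x < y} d)"
    unfolding idQ_def by (subst wfrec) simp_all
  moreover have "Qset (oseg d) (cut idQ {(x, y). x < y} d) = Qset (oseg d) idQ"
    by (rule Qset_cong) (simp add: cut_def)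
  ultimately show ?thesis unfolding idset_def by simp
qed

section \<open>Closure properties of the ideals\<close>

lemma predense_Qset: "predense (Qset D I) (Qset D I)"
  unfolding predense_def compatible_def by blast

lemma idset_subset: "\<lbrakk>A \<in> idset D I; B \<subseteq> A\<rbrakk> \<Longrightarrow> B \<in> idset D I"
  unfolding idset_def by blast

lemma idset_funs: "A \<in> idset D I \<Longrightarrow> A \<subseteq> funs D"
  by (simp add: idset_def)

lemma empty_in_idset: "{} \<in> idset D I"
  unfolding idset_def by (intro CollectI conjI exI[of _ "\<lambda>_. Qset D I"]) (simp_all add: predense_Qset)

lemma set0_in_idset:
  assumes "predense (Qset D I) J" "D \<noteq> {}" shows "set0 D J \<in> idset D I"
  unfolding idset_def
proof (intro CollectI conjI exI[of _ "\<lambda>_. J"])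
  show "set0 D J \<subseteq> (\<Union>i\<in>D. set0 D J)" using assms(2) by simp
qed (use assms(1) in \<open>auto simp: set0_def\<close>)

lemma UN_in_idset:
  assumes D: "infinite D" "J \<lesssim> D" and A: "\<And>j. j \<in> J \<Longrightarrow> A j \<in> idset D I"
  shows "(\<Union>j\<in>J. A j) \<in> idset D I"
proof -
  have "\<forall>j\<in>J. \<exists>Js :: 'a \<Rightarrow> 'a node set set. (\<forall>i\<in>D. predense (Qset D I) (Js i)) \<and> A j \<subseteq> (\<Union>i\<in>D. set0 D (Js i))"
    using A unfolding idset_def by blast
  from bchoice[OF this] obtain Js where
    Js: "\<forall>j\<in>J. (\<forall>i\<in>D. predense (Qset D I) (Js j i)) \<and> A j \<subseteq> (\<Union>i\<in>D. set0 D (Js j i))" by blast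
  have "J \<times> D \<lesssim> D" by (rule Times_lepoll_infinite[OF D lepoll_refl])
  then obtain g where g: "J \<times> D \<subseteq> g ` D" unfolding lepoll_iff by blast
  \<comment> \<open>The families are reindexed by \<open>D\<close> through \<open>g\<close>. Indices
    not coding a pair receive the whole forcing, which is trivially predense.\<close>
  define K where "K i = (if g i \<in> J \<times> D then Js (fst (g i)) (snd (g i)) else Qset D I)" for i
  have "predense (Qset D I) (K i)" for i
    unfolding K_def using Js predense_Qset by (auto simp: mem_Times_iff)
  moreover have "(\<Union>j\<in>J. A j) \<subseteq> (\<Union>i\<in>D. set0 D (K i))"
  proof
    fix x assume "x \<in> (\<Union>j\<in>J. A j)"
    then obtain j i where ji: "j \<in> J" "i \<in> D" "x \<in> set0 D (Js j i)" using Js by blast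
    then obtain k where k: "k \<in> D" "g k = (j, i)" using g by (metis SigmaI imageE subsetD)
    then have "K k = Js j i" using ji unfolding K_def by simp
    then show "x \<in> (\<Union>i\<in>D. set0 D (K i))" using ji(3) by (intro UN_I[OF k(1)]) simp
  qed
  moreover have "A j \<subseteq> funs D" if "j \<in> J" for j using A[OF that] by (rule idset_funs)
  then have "(\<Union>j\<in>J. A j) \<subseteq> funs D" by blast
  ultimately show ?thesis unfolding idset_def by (intro CollectI conjI exI[of _ K]) simp_all
qed

lemma idQ_subset: "\<lbrakk>A \<in> idQ d; B \<subseteq> A\<rbrakk> \<Longrightarrow> B \<in> idQ d"
  unfolding idQ_unfold[of d] by (rule idset_subset)

lemma empty_in_idQ: "{} \<in> idQ d"
  unfolding idQ_unfold[of d] by (rule empty_in_idset)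

lemma UN_in_idQ:
  assumes "strongly_inaccessible d" "J \<lesssim> oseg d" "\<And>j. j \<in> J \<Longrightarrow> A j \<in> idQ d"
  shows "(\<Union>j\<in>J. A j) \<in> idQ d"
proof -
  have "infinite (oseg d)"
    using assms(1) inaccessible_in_infinite unfolding strongly_inaccessible_iff by blast
  then show ?thesis using UN_in_idset[of "oseg d" J A idQ] assms(2,3) by (simp add: idQ_unfold[of d])
qed

lemma Un_in_idQ:
  assumes "strongly_inaccessible d" "A \<in> idQ d" "B \<in> idQ d" shows "A \<union> B \<in> idQ d"
proof -
  have "infinite (oseg d)"
    using assms(1) inaccessible_in_infinite unfolding strongly_inaccessible_iff by blast
  then have "(UNIV::bool set) \<lesssim> oseg d" by (rule finite_lepoll_infinite) simp
  then have "(\<Union>b\<in>UNIV. if b then A else B) \<in> idQ d"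
    using assms by (intro UN_in_idQ) auto
  then show ?thesis by (rule idQ_subset) (auto simp: UNIV_bool)
qed

lemma gap_witness:
  assumes "witness D p S N" "d \<in> gaps D p" shows "d \<in> S \<and> gap p d \<subseteq> N d"
proof
  have d: "d \<in> D" "is_limit d" "gap p d \<noteq> {}" using assms(2) by (auto simp: gaps_def)
  have nd: "(d, x) \<in> nodes D" if "x \<in> gap p d" for x
    using that d(1) by (auto simp: gap_def intro: fun_node)
  show dS: "d \<in> S"
  proof (rule ccontr)
    assume "d \<notin> S"
    obtain x where x: "x \<in> gap p d" using d(3) by blast
    then have "(d, x) \<in> p"
      using assms(1) d \<open>d \<notin> S\<close> nd[OF x] unfolding witness_def by (auto simp: gap_def)
    then show False using x by (auto simp: gap_def)
  qed
  show "gap p d \<subseteq> N d"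
  proof
    fix x assume x: "x \<in> gap p d"
    then have "\<forall>s<d. restr x s \<in> p" "(d, x) \<notin> p" by (auto simp: gap_def)
    moreover have "(d, x) \<in> p \<longleftrightarrow> (\<forall>s<d. restr x s \<in> p) \<and> x \<notin> N d"
      using assms(1) dS nd[OF x] unfolding witness_def by force
    ultimately show "x \<in> N d" by blast
  qed
qed

lemma cond_witness:
  assumes "cond D p" shows "witness D p (gaps D p) (gap p)"
proof -
  have tr: "tree D p" using assms by (simp add: cond_def)
  have down: "restr (snd \<eta>) s \<in> p" if "\<eta> \<in> p" "s < fst \<eta>" for \<eta> s
    using tr that unfolding tree_def by (meson less_imp_le)
  have up: "\<eta> \<in> p" if "\<eta> \<in> nodes D" "\<forall>s<fst \<eta>. restr (snd \<eta>) s \<in> p" "snd \<eta> \<notin> gap p (fst \<eta>)" for \<eta>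
    using that node_fun[OF that(1)] unfolding gap_def by simp
  have ng: "snd \<eta> \<notin> gap p (fst \<eta>)" if "\<eta> \<in> p" for \<eta>
    using that unfolding gap_def by simp
  show ?thesis unfolding witness_def
  proof (intro conjI ballI impI)
    show "tree D p" "\<exists>\<tau>. trunk p \<tau>" "gaps D p \<subseteq> S_inc D" "nowhere_stationary D (gaps D p)"
      using assms by (auto simp: cond_def)
  next
    fix d \<eta> assume "d \<in> D" "is_limit d \<and> d \<notin> gaps D p" "\<eta> \<in> nodes D" "fst \<eta> = d"
    moreover from this have "gap p d = {}" by (auto simp: gaps_def)
    ultimately show "\<eta> \<in> p \<longleftrightarrow> (\<forall>s<d. restr (snd \<eta>) s \<in> p)" using up[of \<eta>] down[of \<eta>] by auto
  next
    fix d \<eta> assume "d \<in> gaps D p" "\<eta> \<in> nodes D" "fst \<eta> = d"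
    then show "\<eta> \<in> p \<longleftrightarrow> (\<forall>s<d. restr (snd \<eta>) s \<in> p) \<and> snd \<eta> \<notin> gap p d"
      using up[of \<eta>] down[of \<eta>] ng[of \<eta>] by auto
  qed
qed

text \<open>Any witness contains the least one. Passing to it is harmless because \<open>idQ\<close>
  and nowhere stationarity are inherited by subsets.\<close>

lemma Qset_iff_cond: "p \<in> Qset D idQ \<longleftrightarrow> cond D p"
proof
  assume "p \<in> Qset D idQ"
  then obtain S N where w: "witness D p S N" "\<forall>d\<in>S. N d \<in> idQ d" unfolding Qset_iff_witness by blast
  then have S: "gaps D p \<subseteq> S" using gap_witness by blast
  have "gap p d \<in> idQ d" if "d \<in> gaps D p" for d
    using gap_witness[OF w(1) that] w(2) idQ_subset by blast
  moreover have "nowhere_stationary D (gaps D p)"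
    using w(1) S nowhere_stationary_subset unfolding witness_def by blast
  ultimately show "cond D p" using w(1) S unfolding cond_def witness_def by blast
next
  assume "cond D p"
  then show "p \<in> Qset D idQ"
    using cond_witness unfolding Qset_iff_witness cond_def by blast
qed

section \<open>Trunks decide compatibility\<close>

lemma treeD: "\<lbrakk>tree D p; \<eta> \<in> p; s \<le> fst \<eta>\<rbrakk> \<Longrightarrow> restr (snd \<eta>) s \<in> p"
  by (simp add: tree_def)

lemma tree_initseg:
  assumes "tree D p" "\<nu> \<in> p" "initseg \<eta> \<nu>" "\<eta> \<in> nodes E" shows "\<eta> \<in> p"
proof -
  have "restr (snd \<nu>) (fst \<eta>) \<in> p"
    using assms(3) by (intro treeD[OF assms(1,2)]) (simp add: initseg_def)
  then show ?thesis unfolding initseg_restr[OF assms(3,4), symmetric] .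
qed

text \<open>If \<open>\<nu>\<close> and \<open>\<tau>\<close> differed, their common part up to the
  first difference would split in \<open>p\<close>. It would then extend the trunk while being
  shorter than it.\<close>

lemma trunk_comparable:
  assumes p: "tree D p" "trunk p \<tau>" and \<nu>: "\<nu> \<in> p"
  shows "initseg \<tau> \<nu> \<or> initseg \<nu> \<tau>"
proof (rule ccontr)
  assume n: "\<not> ?thesis"
  have \<tau>: "\<tau> \<in> p" by (rule trunk_mem[OF p(2)])
  have "\<exists>y. y < fst \<tau> \<and> y < fst \<nu> \<and> snd \<tau> y \<noteq> snd \<nu> y"
    using n unfolding initseg_def by (meson less_le_trans linear)
  then obtain m where m: "m < fst \<tau>" "m < fst \<nu>" "snd \<tau> m \<noteq> snd \<nu> m"
    "\<And>y. y < m \<Longrightarrow> \<not> (y < fst \<tau> \<and> y < fst \<nu> \<and> snd \<tau> y \<noteq> snd \<nu> y)"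
    using exists_least_iff[of "\<lambda>y. y < fst \<tau> \<and> y < fst \<nu> \<and> snd \<tau> y \<noteq> snd \<nu> y"] by blast
  define \<sigma> where "\<sigma> = restr (snd \<tau>) m"
  have "\<sigma> = restr (snd \<nu>) m"
    using m unfolding \<sigma>_def restr_def by (auto simp: fun_eq_iff)
  moreover have "(LEAST z. m < z) \<le> fst \<tau>" "(LEAST z. m < z) \<le> fst \<nu>" using m by (simp_all add: Least_le)
  ultimately have "extn \<sigma> (snd \<tau> m) \<in> p" "extn \<sigma> (snd \<nu> m) \<in> p"
    using extn_restr[OF m(1)] extn_restr[OF m(2)] treeD[OF p(1) \<tau>] treeD[OF p(1) \<nu>] \<sigma>_def by metis+
  then have "extn \<sigma> False \<in> p \<and> extn \<sigma> True \<in> p" using m(3) by (cases "snd \<tau> m"; cases "snd \<nu> m") auto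
  moreover have "\<sigma> \<in> p" unfolding \<sigma>_def using treeD[OF p(1) \<tau>] m(1) by (simp add: less_imp_le)
  ultimately have "initseg \<tau> \<sigma>" using trunk_least[OF p(2)] by blast
  then show False using m(1) unfolding initseg_def \<sigma>_def by auto
qed

lemma gap_Int: "gap (p \<inter> q) d \<subseteq> gap p d \<union> gap q d"
  by (auto simp: gap_def)

lemma gap_in_idQ: "\<lbrakk>cond D p; d \<in> D; is_limit d\<rbrakk> \<Longrightarrow> gap p d \<in> idQ d"
  by (cases "gap p d = {}") (auto simp: empty_in_idQ cond_def gaps_def)

text \<open>From \<open>\<tau>\<close> on both trees split at every node, and a node splitting in
  the intersection splits in \<open>q\<close>, hence extends \<open>\<tau>\<close>. A gap of the
  intersection is covered by the gaps of the two conditions.\<close>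

lemma cond_Int:
  assumes D: "down D" and p: "cond D p" "trunk p \<sigma>" and q: "cond D q" "trunk q \<tau>"
    and \<sigma>\<tau>: "initseg \<sigma> \<tau>" "\<tau> \<in> p"
  shows "cond D (p \<inter> q)" "trunk (p \<inter> q) \<tau>"
proof -
  show t: "trunk (p \<inter> q) \<tau>"
  proof (rule trunkI)
    show "\<tau> \<in> p \<inter> q" using trunk_mem[OF q(2)] \<sigma>\<tau>(2) by blast
  next
    fix \<nu> assume "\<nu> \<in> p \<inter> q" "extn \<nu> False \<in> p \<inter> q" "extn \<nu> True \<in> p \<inter> q"
    then show "initseg \<tau> \<nu>" using trunk_least[OF q(2), of \<nu>] by blast
  next
    fix \<eta> b assume \<eta>: "\<eta> \<in> p \<inter> q" "initseg \<tau> \<eta>"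
    then show "extn \<eta> b \<in> p \<inter> q"
      using trunk_extn[OF q(2), of \<eta> b] trunk_extn[OF p(2), of \<eta> b] initseg_trans[OF \<sigma>\<tau>(1) \<eta>(2)] by blast
  qed
  have g: "gaps D (p \<inter> q) \<subseteq> gaps D p \<union> gaps D q" using gap_Int[of p q] unfolding gaps_def by blast
  have "tree D (p \<inter> q)" using p(1) q(1) unfolding cond_def tree_def by blast
  moreover have si: "gaps D (p \<inter> q) \<subseteq> S_inc D" using g p(1) q(1) unfolding cond_def by blast
  moreover have "nowhere_stationary D (gaps D (p \<inter> q))"
    using nowhere_stationary_subset[OF nowhere_stationary_Un[OF D] g] p(1) q(1) unfolding cond_def by blast
  moreover have "gap (p \<inter> q) d \<in> idQ d" if d: "d \<in> gaps D (p \<inter> q)" for d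
  proof -
    have "d \<in> D" "is_limit d" "strongly_inaccessible d" using d si by (auto simp: gaps_def S_inc_def)
    then have "gap p d \<union> gap q d \<in> idQ d" using gap_in_idQ p(1) q(1) Un_in_idQ by blast
    then show ?thesis using gap_Int by (rule idQ_subset)
  qed
  ultimately show "cond D (p \<inter> q)" using t unfolding cond_def by blast
qed

text \<open>The trunk of a common refinement splits in both conditions, so it extends both trunks.
  Conversely the intersection is a condition by \<open>cond_Int\<close>.\<close>

lemma compatible_iff:
  assumes D: "down D" and p: "cond D p" "trunk p \<sigma>" and q: "cond D q" "trunk q \<tau>"
  shows "compatible (Qset D idQ) p q \<longleftrightarrow> initseg \<sigma> \<tau> \<and> \<tau> \<in> p \<or> initseg \<tau> \<sigma> \<and> \<sigma> \<in> q"
proof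
  assume "compatible (Qset D idQ) p q"
  then obtain r where "r \<in> Qset D idQ" and r: "r \<subseteq> p" "r \<subseteq> q" unfolding compatible_def by blast
  then have cr: "cond D r" by (simp add: Qset_iff_cond)
  obtain \<rho> where \<rho>: "trunk r \<rho>" using cr unfolding cond_def by blast
  have "\<rho> \<in> r" "extn \<rho> False \<in> r" "extn \<rho> True \<in> r"
    using trunk_mem[OF \<rho>] trunk_extn[OF \<rho> trunk_mem[OF \<rho>] initseg_refl] by blast+
  then have i: "initseg \<sigma> \<rho>" "initseg \<tau> \<rho>"
    using trunk_least[OF p(2), of \<rho>] trunk_least[OF q(2), of \<rho>] r by blast+
  have tr: "tree D r" using cr by (simp add: cond_def)
  have "p \<subseteq> nodes D" "q \<subseteq> nodes D" using p(1) q(1) by (simp_all add: cond_def tree_def)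
  moreover have "\<sigma> \<in> p" "\<tau> \<in> q" using trunk_mem[OF p(2)] trunk_mem[OF q(2)] .
  ultimately have n: "\<sigma> \<in> nodes D" "\<tau> \<in> nodes D" by blast+
  have "\<sigma> \<in> r" by (rule tree_initseg[OF tr \<open>\<rho> \<in> r\<close> i(1) n(1)])
  moreover have "\<tau> \<in> r" by (rule tree_initseg[OF tr \<open>\<rho> \<in> r\<close> i(2) n(2)])
  ultimately show "initseg \<sigma> \<tau> \<and> \<tau> \<in> p \<or> initseg \<tau> \<sigma> \<and> \<sigma> \<in> q"
    using initseg_comparable[OF i] initseg_comparable[OF i(2,1)] r linear[of "fst \<sigma>" "fst \<tau>"] by blast
next
  assume "initseg \<sigma> \<tau> \<and> \<tau> \<in> p \<or> initseg \<tau> \<sigma> \<and> \<sigma> \<in> q"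
  then have "cond D (p \<inter> q)"
    using cond_Int(1)[OF D p q] cond_Int(1)[OF D q p] by (auto simp: Int_commute)
  then show "compatible (Qset D idQ) p q"
    unfolding compatible_def by (intro bexI[of _ "p \<inter> q"]) (auto simp: Qset_iff_cond)
qed

section \<open>Restricting conditions to an initial segment\<close>

lemma nowhere_stationary_oseg:
  assumes "nowhere_stationary UNIV X" shows "nowhere_stationary (oseg a) (X \<inter> oseg a)"
  unfolding nowhere_stationary_def
proof (intro conjI ballI impI)
  fix D assume D: "D \<in> insert (oseg a) (oseg ` oseg a)" "uncountable_cof D"
  then have "D \<subseteq> oseg a" "D \<in> range oseg" by auto
  moreover from this have "nonstationary_in D (X \<inter> D)"
    using assms D(2) unfolding nowhere_stationary_def by blast
  ultimately show "nonstationary_in D (X \<inter> oseg a \<inter> D)" by (simp add: Int_assoc inf.absorb2)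
qed simp

text \<open>Level \<open>y\<close> is included, so that the gap at \<open>y\<close> itself is the
  same for both sets.\<close>

definition agree :: "'k::wellorder \<Rightarrow> 'k node set \<Rightarrow> 'k node set \<Rightarrow> bool" where
  "agree y p q \<longleftrightarrow> (\<forall>\<eta>\<in>nodes UNIV. fst \<eta> \<le> y \<longrightarrow> (\<eta> \<in> p \<longleftrightarrow> \<eta> \<in> q))"

lemma agreeD: "\<lbrakk>agree y p q; \<eta> \<in> nodes UNIV; fst \<eta> \<le> y\<rbrakk> \<Longrightarrow> \<eta> \<in> p \<longleftrightarrow> \<eta> \<in> q"
  by (simp add: agree_def)

lemma gap_agree:
  assumes "agree y p q" "d \<le> y" shows "gap p d = gap q d"
proof -
  have "restr x s \<in> p \<longleftrightarrow> restr x s \<in> q" if "s < d" for x s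
    using agreeD[OF assms(1) restr_in_nodes[of s UNIV x]] that assms(2) by simp
  moreover have "(d, x) \<in> p \<longleftrightarrow> (d, x) \<in> q" if "x \<in> funs (oseg d)" for x
    using agreeD[OF assms(1) fun_node[of d UNIV x]] that assms(2) by simp
  ultimately show ?thesis unfolding gap_def by auto
qed

lemma fst_extn_less_limit:
  assumes "is_limit d" "fst \<eta> < d" shows "fst (extn \<eta> b) < d"
proof -
  obtain w where w: "fst \<eta> < w" "w < d" using assms by (auto simp: is_limit_def)
  then show ?thesis unfolding fst_extn using Least_le[of "\<lambda>z. fst \<eta> < z" w] by simp
qed

text \<open>As \<open>d\<close> is a limit, successors of nodes below \<open>d\<close> stay below
  \<open>d\<close>, so splitting survives. The gaps that remain are those of \<open>p\<close> below
  \<open>d\<close>.\<close>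

lemma cond_oseg:
  assumes p: "cond UNIV p" "trunk p \<tau>" and d: "is_limit d" "fst \<tau> < d"
  shows "cond (oseg d) (p \<inter> nodes (oseg d))" "trunk (p \<inter> nodes (oseg d)) \<tau>"
proof -
  let ?r = "p \<inter> nodes (oseg d)"
  have pn: "p \<subseteq> nodes UNIV" using p(1) by (simp add: cond_def tree_def)
  have mem: "\<eta> \<in> ?r \<longleftrightarrow> \<eta> \<in> p \<and> fst \<eta> < d" for \<eta> using pn by (auto simp: nodes_def)
  have ext: "extn \<eta> b \<in> ?r \<longleftrightarrow> extn \<eta> b \<in> p" if "fst \<eta> < d" for \<eta> b
    using fst_extn_less_limit[OF d(1) that] mem by blast
  show t: "trunk ?r \<tau>"
  proof (rule trunkI)
    show "\<tau> \<in> ?r" using trunk_mem[OF p(2)] d(2) mem[of \<tau>] by blast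
  next
    fix \<nu> assume "\<nu> \<in> ?r" "extn \<nu> False \<in> ?r" "extn \<nu> True \<in> ?r"
    then show "initseg \<tau> \<nu>" using trunk_least[OF p(2), of \<nu>] by blast
  next
    fix \<eta> b assume \<eta>: "\<eta> \<in> ?r" "initseg \<tau> \<eta>"
    then have "fst \<eta> < d" "extn \<eta> b \<in> p" using mem[of \<eta>] trunk_extn[OF p(2), of \<eta>] by blast+
    then show "extn \<eta> b \<in> ?r" using ext by blast
  qed
  have tp: "tree UNIV p" using p(1) by (simp add: cond_def)
  have "restr (snd \<eta>) s \<in> ?r" if "\<eta> \<in> ?r" "s \<le> fst \<eta>" for \<eta> s
    using that treeD[OF tp _ that(2)] le_less_trans[OF that(2)] unfolding mem by simp
  then have "tree (oseg d) ?r" unfolding tree_def by blast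
  moreover have gap: "gap ?r e = gap p e" if "e < d" for e
  proof (rule gap_agree[of e])
    show "agree e ?r p" unfolding agree_def mem using that by (blast intro: le_less_trans)
  qed simp
  then have g: "gaps (oseg d) ?r = gaps UNIV p \<inter> oseg d" unfolding gaps_def by auto
  moreover have "gaps UNIV p \<inter> oseg d \<subseteq> S_inc (oseg d)"
    using p(1) unfolding cond_def S_inc_def by auto
  moreover have "nowhere_stationary (oseg d) (gaps UNIV p \<inter> oseg d)"
    using p(1) nowhere_stationary_oseg unfolding cond_def by blast
  moreover have "\<forall>e\<in>gaps UNIV p \<inter> oseg d. gap ?r e \<in> idQ e"
    using p(1) gap unfolding cond_def by auto
  moreover have "\<exists>\<tau>. trunk ?r \<tau>" using t by blast
  ultimately show "cond (oseg d) ?r" unfolding cond_def g by (intro conjI)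
qed

text \<open>Conditions with equal trunks are compatible. Consequently the members of an antichain
  with short trunks are no more numerous than the short nodes.\<close>

lemma trunk_injective:
  assumes D: "down D" and A: "max_antichain (Qset D idQ) A" and t: "\<And>p. p \<in> A \<Longrightarrow> trunk p (t p)"
  shows "inj_on t A"
proof (rule inj_onI)
  fix p q assume pq: "p \<in> A" "q \<in> A" "t p = t q"
  then have "p \<in> Qset D idQ" "q \<in> Qset D idQ" using A unfolding max_antichain_def by blast+
  then have "cond D p" "cond D q" by (simp_all add: Qset_iff_cond)
  then have "compatible (Qset D idQ) p q"
    using compatible_iff[OF D _ t[OF pq(1)] _ t[OF pq(2)]] pq(3) trunk_mem[OF t[OF pq(1)]] by simp
  then show "p = q" using A pq unfolding max_antichain_def by blast
qed

section \<open>From nowhere stationary avoidance to antichains\<close>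

text \<open>The weakest condition with trunk \<open>\<tau>\<close> that has its gaps inside \<open>N\<close>.\<close>
definition avoiding :: "'k::wellorder node \<Rightarrow> 'k set \<Rightarrow> ('k \<Rightarrow> ('k \<Rightarrow> bool) set) \<Rightarrow> 'k node set" where
  "avoiding \<tau> S N = {\<eta> \<in> nodes UNIV. initseg \<eta> \<tau> \<or> initseg \<tau> \<eta> \<and>
     (\<forall>d\<in>S. fst \<tau> < d \<and> d \<le> fst \<eta> \<longrightarrow> snd (restr (snd \<eta>) d) \<notin> N d)}"

lemma avoidingD:
  assumes "\<eta> \<in> avoiding \<tau> S N" "d \<in> S" "fst \<tau> < d" "d \<le> fst \<eta>"
  shows "snd (restr (snd \<eta>) d) \<notin> N d"
proof -
  have "\<not> initseg \<eta> \<tau>" using assms(3,4) unfolding initseg_def by auto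
  then show ?thesis using assms unfolding avoiding_def by blast
qed

lemma avoiding_comparable: "\<eta> \<in> avoiding \<tau> S N \<Longrightarrow> initseg \<eta> \<tau> \<or> initseg \<tau> \<eta>"
  unfolding avoiding_def by blast

lemma initseg_comparable_values:
  "\<lbrakk>initseg \<eta> \<nu> \<or> initseg \<nu> \<eta>; y < fst \<eta>; y < fst \<nu>\<rbrakk> \<Longrightarrow> snd \<eta> y = snd \<nu> y"
  unfolding initseg_def by auto

lemma tree_avoiding:
  shows "tree UNIV (avoiding \<tau> S N)"
  unfolding tree_def
proof (intro conjI ballI allI impI)
  show "avoiding \<tau> S N \<subseteq> nodes UNIV" unfolding avoiding_def by blast
  fix \<eta> s assume \<eta>: "\<eta> \<in> avoiding \<tau> S N" "s \<le> fst \<eta>"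
  let ?\<rho> = "restr (snd \<eta>) s"
  have \<rho>: "?\<rho> \<in> nodes UNIV" "initseg ?\<rho> \<eta>"
    using restr_in_nodes[of s UNIV] restr_initseg[OF \<eta>(2)] by auto
  show "?\<rho> \<in> avoiding \<tau> S N"
  proof (cases "initseg ?\<rho> \<tau>")
    case True
    then show ?thesis using \<rho>(1) unfolding avoiding_def by blast
  next
    case False
    then have "\<not> initseg \<eta> \<tau>" using initseg_trans[OF \<rho>(2)] by blast
    then have i: "initseg \<tau> \<eta>" using avoiding_comparable[OF \<eta>(1)] by blast
    then have "initseg \<tau> ?\<rho>"
      using False initseg_comparable[OF \<rho>(2) i] initseg_comparable[OF i \<rho>(2)] linear by blast
    moreover have "snd (restr (snd ?\<rho>) d) \<notin> N d" if "d \<in> S" "fst \<tau> < d" "d \<le> s" for d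
      using avoidingD[OF \<eta>(1) that(1,2)] restr_restr[OF that(3), of "snd \<eta>"] that(3) \<eta>(2) by simp
    ultimately show ?thesis using \<rho>(1) unfolding avoiding_def by simp
  qed
qed

lemma extn_in_nodes:
  assumes "fst \<eta> < z" "\<eta> \<in> nodes UNIV" shows "extn \<eta> b \<in> nodes UNIV"
proof -
  have "\<not> snd (extn \<eta> b) y" if "fst (extn \<eta> b) \<le> y" for y
  proof -
    have "fst \<eta> < y" using that less_fst_extn[OF assms(1), of y b] by (simp add: not_le[symmetric])
    then show ?thesis using assms(2) by (auto simp: extn_def nodes_def)
  qed
  then show ?thesis by (simp add: nodes_def)
qed

lemma trunk_avoiding:
  assumes gt: "\<forall>a::'k::wellorder. \<exists>b. a < b" and \<tau>: "\<tau> \<in> nodes (UNIV::'k set)" and S: "S \<subseteq> S_inc UNIV"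
  shows "trunk (avoiding \<tau> S N) \<tau>"
proof (rule trunkI)
  show "\<tau> \<in> avoiding \<tau> S N" using \<tau> unfolding avoiding_def by simp
next
  fix \<nu> assume \<nu>: "\<nu> \<in> avoiding \<tau> S N" "extn \<nu> False \<in> avoiding \<tau> S N" "extn \<nu> True \<in> avoiding \<tau> S N"
  obtain z where z: "fst \<nu> < z" using gt by blast
  show "initseg \<tau> \<nu>"
  proof (rule ccontr)
    assume n: "\<not> initseg \<tau> \<nu>"
    then have i: "initseg \<nu> \<tau>" using avoiding_comparable[OF \<nu>(1)] by blast
    have less: "fst \<nu> < fst \<tau>"
    proof (rule ccontr)
      assume "\<not> fst \<nu> < fst \<tau>"
      then show False using n i initseg_comparable[OF initseg_refl i] by simp
    qed
    \<comment> \<open>Below \<open>\<tau>\<close> the tree follows \<open>\<tau>\<close> alone, so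
      both extensions would carry the value of \<open>\<tau>\<close> at
      \<open>fst \<nu>\<close>.\<close>
    have "snd (extn \<nu> b) (fst \<nu>) = snd \<tau> (fst \<nu>)" if "extn \<nu> b \<in> avoiding \<tau> S N" for b
      using initseg_comparable_values[OF avoiding_comparable[OF that], of "fst \<nu>"]
        less less_fst_extn[OF z, of "fst \<nu>" b] by simp
    from this[OF \<nu>(2)] this[OF \<nu>(3)] show False by (simp add: extn_def)
  qed
next
  fix \<eta> b assume \<eta>: "\<eta> \<in> avoiding \<tau> S N" "initseg \<tau> \<eta>"
  obtain z where z: "fst \<eta> < z" using gt by blast
  have \<eta>n: "\<eta> \<in> nodes UNIV" using \<eta>(1) unfolding avoiding_def by blast
  have le: "fst \<tau> \<le> fst \<eta>" using \<eta>(2) by (simp add: initseg_def)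
  have lt: "y < fst (extn \<eta> b) \<longleftrightarrow> y \<le> fst \<eta>" for y by (rule less_fst_extn[OF z])
  have same: "snd (extn \<eta> b) y = snd \<eta> y" if "y < fst \<eta>" for y
    using that by (auto simp: extn_def)
  have "fst \<tau> \<le> fst (extn \<eta> b)" using lt[of "fst \<tau>"] le by simp
  then have "initseg \<tau> (extn \<eta> b)"
    using \<eta>(2) same le unfolding initseg_def by (simp add: less_le_trans)
  moreover have "snd (restr (snd (extn \<eta> b)) d) \<notin> N d" if d: "d \<in> S" "fst \<tau> < d" "d \<le> fst (extn \<eta> b)" for d
  proof -
    \<comment> \<open>Levels in \<open>S\<close> are limits and the level of \<open>extn\<close> is
      a successor, so the extension meets no new constraint.\<close>
    have "is_limit d" using d(1) S strongly_inaccessible_limit by (auto simp: S_inc_def)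
    then have "d \<noteq> fst (extn \<eta> b)" using lt lt[of "fst \<eta>"] by (auto simp: is_limit_def not_less[symmetric])
    then have "d < fst (extn \<eta> b)" using d(3) by (rule le_neq_trans[rotated])
    then have "d \<le> fst \<eta>" using lt by simp
    moreover from this have "restr (snd (extn \<eta> b)) d = restr (snd \<eta>) d"
      using same by (auto simp: restr_def fun_eq_iff)
    ultimately show ?thesis using avoidingD[OF \<eta>(1) d(1,2)] by simp
  qed
  ultimately show "extn \<eta> b \<in> avoiding \<tau> S N"
    using extn_in_nodes[OF z \<eta>n] unfolding avoiding_def by blast
qed

text \<open>A constraint violated below \<open>d\<close> would already exclude a proper restriction
  of \<open>x\<close>, so the violation occurs at \<open>d\<close>.\<close>

lemma gap_avoiding:
  assumes \<tau>: "\<tau> \<in> nodes (UNIV::'k::wellorder set)" and d: "is_limit d" and x: "x \<in> gap (avoiding \<tau> S N) d"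
  shows "d \<in> S \<and> x \<in> N d"
proof -
  let ?p = "avoiding \<tau> S N"
  have xf: "x \<in> funs (oseg d)" and r: "\<And>s. s < d \<Longrightarrow> restr x s \<in> ?p" and n: "(d, x) \<notin> ?p"
    using x unfolding gap_def by blast+
  have node: "(d, x) \<in> nodes UNIV" by (rule fun_node[OF UNIV_I xf])
  have eq: "x y = snd \<tau> y" if y: "y < d" "y < fst \<tau>" for y
  proof -
    obtain s where s: "y < s" "s < d" using d y(1) by (auto simp: is_limit_def)
    show ?thesis
      using initseg_comparable_values[OF avoiding_comparable[OF r[OF s(2)]], of y] y(2) s(1)
      by (simp add: snd_restr)
  qed
  have \<tau>d: "fst \<tau> < d"
  proof (rule ccontr)
    assume "\<not> fst \<tau> < d"
    then have "initseg (d, x) \<tau>" using eq unfolding initseg_def by auto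
    then show False using n node unfolding avoiding_def by blast
  qed
  then have "initseg \<tau> (d, x)" using eq unfolding initseg_def by auto
  then obtain e where e: "e \<in> S" "fst \<tau> < e" "e \<le> d" "snd (restr x e) \<in> N e"
    using n node unfolding avoiding_def by auto
  have "e = d"
  proof (rule ccontr)
    assume "e \<noteq> d"
    then have "restr x e \<in> ?p" using e(3) r by simp
    from avoidingD[OF this e(1,2)] show False using e(4) restr_restr[OF order_refl, of x e] by simp
  qed
  then show ?thesis using e restr_eq_fun[OF xf] by simp
qed

lemma cond_avoiding:
  assumes gt: "\<forall>a::'k::wellorder. \<exists>b. a < b" and \<tau>: "\<tau> \<in> nodes (UNIV::'k set)"
    and S: "S \<subseteq> S_inc UNIV" "nowhere_stationary UNIV S" and N: "\<forall>d\<in>S. N d \<in> idQ d"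
  shows "cond UNIV (avoiding \<tau> S N)"
proof -
  let ?p = "avoiding \<tau> S N"
  have g: "d \<in> S \<and> gap ?p d \<subseteq> N d" if "d \<in> gaps UNIV ?p" for d
    using that gap_avoiding[OF \<tau>, of d _ S N] unfolding gaps_def by blast
  then have "gaps UNIV ?p \<subseteq> S" by blast
  then have "nowhere_stationary UNIV (gaps UNIV ?p)" "gaps UNIV ?p \<subseteq> S_inc UNIV"
    using S nowhere_stationary_subset by blast+
  moreover have "\<forall>d\<in>gaps UNIV ?p. gap ?p d \<in> idQ d" using g N idQ_subset by blast
  ultimately show ?thesis
    unfolding cond_def using tree_avoiding trunk_avoiding[OF gt \<tau> S(1)] by blast
qed

section \<open>Maximal antichains inside a dense set\<close>

lemma compatible_mono: "\<lbrakk>compatible Q p r; r \<subseteq> q\<rbrakk> \<Longrightarrow> compatible Q p q"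
  unfolding compatible_def by blast

lemma compatible_sym: "compatible Q p q \<Longrightarrow> compatible Q q p"
  unfolding compatible_def by blast

text \<open>Zorn's lemma gives a maximal antichain within \<open>E\<close>. An element of
  \<open>E\<close> below \<open>q\<close> cannot be added to it, so it is compatible with a member,
  and then so is \<open>q\<close>.\<close>

lemma max_antichain_below:
  assumes E: "E \<subseteq> Q" and dense: "\<And>q. q \<in> Q \<Longrightarrow> \<exists>r\<in>E. r \<subseteq> q"
  shows "\<exists>M\<subseteq>E. max_antichain Q M"
proof -
  define F where "F = {B. B \<subseteq> E \<and> (\<forall>p\<in>B. \<forall>p'\<in>B. p \<noteq> p' \<longrightarrow> \<not> compatible Q p p')}"
  have "\<exists>M\<in>F. \<forall>X\<in>F. M \<subseteq> X \<longrightarrow> X = M"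
  proof (rule subset_Zorn')
    fix C assume C: "subset.chain F C"
    then have CF: "C \<subseteq> F" and lin: "\<And>X Y. \<lbrakk>X \<in> C; Y \<in> C\<rbrakk> \<Longrightarrow> X \<subseteq> Y \<or> Y \<subseteq> X"
      unfolding subset_chain_def by blast+
    have "\<not> compatible Q p p'" if pp: "p \<in> \<Union>C" "p' \<in> \<Union>C" "p \<noteq> p'" for p p'
    proof -
      obtain X Y where XY: "X \<in> C" "p \<in> X" "Y \<in> C" "p' \<in> Y" using pp(1,2) by blast
      obtain Z where "Z \<in> C" "p \<in> Z" "p' \<in> Z" using lin[OF XY(1,3)] XY by blast
      then show ?thesis using CF pp(3) unfolding F_def by blast
    qed
    then show "\<Union>C \<in> F" using CF unfolding F_def by blast
  qed
  then obtain M where M: "M \<in> F" "\<And>X. \<lbrakk>X \<in> F; M \<subseteq> X\<rbrakk> \<Longrightarrow> X = M" by blast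
  have "\<exists>p\<in>M. compatible Q p q" if q: "q \<in> Q" for q
  proof -
    obtain r where r: "r \<in> E" "r \<subseteq> q" using dense[OF q] by blast
    have "\<exists>p\<in>M. compatible Q p r"
    proof (cases "r \<in> M")
      case True
      then show ?thesis using r(1) E unfolding compatible_def by blast
    next
      case False
      then have "insert r M \<notin> F" using M(2)[of "insert r M"] by blast
      then have "\<exists>p\<in>M. compatible Q p r \<or> compatible Q r p"
        using M(1) r(1) unfolding F_def by blast
      then show ?thesis using compatible_sym by blast
    qed
    then show ?thesis using compatible_mono[OF _ r(2)] by blast
  qed
  then show ?thesis using M(1) E unfolding max_antichain_def F_def by (intro exI[of _ M]) blast
qed

lemma id_minus_subset_wid:
  assumes gt: "\<forall>a::'k::wellorder. \<exists>b. a < b"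
  shows "(id_minus :: ('k \<Rightarrow> bool) set set) \<subseteq> wid"
proof
  fix X :: "('k \<Rightarrow> bool) set" assume "X \<in> id_minus"
  then obtain S N where X: "X \<subseteq> funs UNIV"
    and S: "S \<subseteq> S_inc UNIV" "nowhere_stationary UNIV S" and N: "\<forall>d\<in>S. N d \<in> idQ d"
    and XN: "X \<subseteq> {x \<in> funs UNIV. \<forall>a. \<exists>d\<in>S. a \<le> d \<and> snd (restr x d) \<in> N d}"
    unfolding id_minus_def by blast
  \<comment> \<open>Dense, since a condition can be intersected with \<open>avoiding\<close> for its
    own trunk. A branch through a member of \<open>E\<close> meets no \<open>N d\<close> above that
    \<open>\<tau>\<close>.\<close>
  define E where "E = {q \<in> Qset UNIV idQ. \<exists>\<tau>. q \<subseteq> avoiding \<tau> S N}"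
  have "\<exists>r\<in>E. r \<subseteq> q" if "q \<in> Qset UNIV idQ" for q
  proof -
    have q: "cond UNIV q" using that by (simp add: Qset_iff_cond)
    then obtain \<tau> where \<tau>: "trunk q \<tau>" unfolding cond_def by blast
    have \<tau>n: "\<tau> \<in> nodes UNIV" using q trunk_mem[OF \<tau>] by (auto simp: cond_def tree_def)
    have "cond UNIV (avoiding \<tau> S N \<inter> q)"
      using cond_Int(1)[OF down_UNIV cond_avoiding[OF gt \<tau>n S N] trunk_avoiding[OF gt \<tau>n S(1)] q \<tau> initseg_refl]
        trunk_mem[OF trunk_avoiding[OF gt \<tau>n S(1)]] by blast
    then have "avoiding \<tau> S N \<inter> q \<in> E" unfolding E_def Qset_iff_cond by blast
    then show ?thesis by blast
  qed
  then obtain M where M: "M \<subseteq> E" "max_antichain (Qset UNIV idQ) M"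
    using max_antichain_below[of E "Qset UNIV idQ"] unfolding E_def by blast
  have "x \<notin> branches UNIV p" if x: "x \<in> X" and p: "p \<in> M" for x p
  proof
    assume b: "x \<in> branches UNIV p"
    obtain \<tau> where \<tau>: "p \<subseteq> avoiding \<tau> S N" using M(1) p unfolding E_def by blast
    obtain a where a: "fst \<tau> < a" using gt by blast
    obtain d where d: "d \<in> S" "a \<le> d" "snd (restr x d) \<in> N d" using XN x by blast
    have "restr x d \<in> avoiding \<tau> S N" using b \<tau> unfolding branches_def by blast
    moreover have "fst \<tau> < d" using a d(2) by simp
    ultimately show False using avoidingD[of "restr x d" \<tau> S N d] d restr_restr[OF order_refl, of x d] by simp
  qed
  then have "X \<subseteq> set0 UNIV M" using X unfolding set0_def by blast
  then show "X \<in> wid" unfolding wid_def QK_def using X M(2) by blast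
qed

section \<open>Weak compactness\<close>

definition unbdd :: "'k::wellorder set \<Rightarrow> bool" where
  "unbdd H \<longleftrightarrow> (\<forall>a. \<exists>x\<in>H. a < x)"

definition settles :: "'k::wellorder set \<Rightarrow> ('k \<Rightarrow> 'a) \<Rightarrow> bool" where
  "settles H g \<longleftrightarrow> (\<exists>v n. \<forall>d\<in>H. n \<le> d \<longrightarrow> g d = v)"

text \<open>The guard exempts the least point, where no smaller value exists.\<close>

definition regressive :: "('k::wellorder \<Rightarrow> 'k) \<Rightarrow> bool" where
  "regressive f \<longleftrightarrow> (\<forall>d. (\<exists>z. z < d) \<longrightarrow> f d < d)"

context
  assumes wc: "weakly_compact TYPE('k::wellorder)"
begin

section \<open>Regularity and convergence from the partition relation\<close>

lemma wc_uncountable: "\<not> countable (UNIV :: 'k set)"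
  and wc_oseg: "oseg (a::'k) \<prec> (UNIV :: 'k set)"
  using wc by (auto simp: weakly_compact_def)

lemma wc_infinite: "infinite (UNIV :: 'k set)"
  using wc_uncountable countable_finite by blast

text \<open>With a greatest point \<open>a\<close>, all of \<kappa> would be the infinite segment
  \<open>oseg a\<close> plus one point, hence no larger than \<open>oseg a\<close>.\<close>

lemma wc_gt: "\<exists>b::'k. a < b"
proof (rule ccontr)
  assume "\<not> ?thesis"
  then have "x \<in> insert a (oseg a)" for x by (metis insertCI linorder_neqE mem_oseg)
  then have U: "insert a (oseg a) = UNIV" by blast
  then have "infinite (oseg a)" using wc_infinite finite.insertI by (metis (no_types))
  from infinite_insert_lepoll[OF this, of a] have "(UNIV::'k set) \<lesssim> oseg a" by (simp only: U)
  then show False using wc_oseg[of a] by (meson lesspoll_not_refl lesspoll_trans2)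
qed

lemma unbdd_if_eqpoll:
  assumes "H \<approx> (UNIV::'k set)" shows "unbdd (H::'k set)"
  unfolding unbdd_def
proof (rule ccontr)
  assume "\<not> (\<forall>a. \<exists>x\<in>H. a < x)"
  then obtain a where a: "\<forall>x\<in>H. x \<le> a" by (auto simp: not_less)
  obtain b where "a < b" using wc_gt by blast
  then have "H \<subseteq> oseg b" using a by auto
  then have "H \<prec> (UNIV::'k set)" using wc_oseg subset_imp_lepoll lesspoll_trans1 by blast
  then show False using assms by (simp add: lesspoll_def)
qed

lemma wc_partition:
  fixes c :: "'k \<Rightarrow> 'k \<Rightarrow> bool"
  shows "\<exists>H b. H \<approx> (UNIV::'k set) \<and> unbdd H \<and> (\<forall>x\<in>H. \<forall>y\<in>H. x < y \<longrightarrow> c x y = b)"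
proof -
  have "\<exists>H. H \<approx> (UNIV::'k set) \<and> (\<exists>b. \<forall>x\<in>H. \<forall>y\<in>H. x < y \<longrightarrow> c x y = b)"
    using wc unfolding weakly_compact_def by (elim conjE allE[of _ c])
  then show ?thesis using unbdd_if_eqpoll by blast
qed

text \<open>This is the regularity of \<kappa>. If the values were unbounded, let \<open>g b\<close>
  in \<open>A\<close> have value at least \<open>b\<close>, and colour a pair by whether
  \<open>g\<close> agrees on it. A set where \<open>g\<close> is constant is bounded by the value of
  that constant, and a set where \<open>g\<close> is injective embeds \<kappa> into
  \<open>A\<close>.\<close>

lemma wc_bound:
  assumes "A \<prec> (UNIV::'k set)"
  shows "\<exists>b. \<forall>a\<in>A. \<nu> a < (b::'k)"
proof (rule ccontr)
  assume "\<not> ?thesis"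
  then have "\<forall>b. \<exists>a. a \<in> A \<and> b \<le> \<nu> a" by (meson not_less)
  from choice[OF this] obtain g where g: "\<forall>b. g b \<in> A \<and> b \<le> \<nu> (g b)" by blast
  obtain H v where H: "H \<approx> (UNIV::'k set)" "unbdd H" "\<forall>x\<in>H. \<forall>y\<in>H. x < y \<longrightarrow> (g x = g y) = v"
    using wc_partition[of "\<lambda>x y. g x = g y"] by blast
  show False
  proof (cases v)
    case True
    obtain x where x: "x \<in> H" using H(2) unfolding unbdd_def by blast
    obtain y where y: "y \<in> H" "max x (\<nu> (g x)) < y" using H(2) unfolding unbdd_def by blast
    then have "g x = g y" using H(3) x True by auto
    then show False using g[rule_format, of y] y by auto
  next
    case False
    have "inj_on g H"
    proof (rule inj_onI)
      fix x y assume xy: "x \<in> H" "y \<in> H" "g x = g y"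
      show "x = y"
        using xy H(3) False by (cases x y rule: linorder_cases) (auto, metis)
    qed
    then have "H \<lesssim> A" unfolding lepoll_def using g by auto
    then have "(UNIV::'k set) \<lesssim> A" using H(1) by (meson eqpoll_sym lepoll_trans1)
    then show False using lesspoll_trans1[OF _ assms] by blast
  qed
qed

lemma lesspoll_imp_lepoll_oseg:
  assumes "A \<prec> (UNIV::'k set)" shows "\<exists>b. A \<lesssim> oseg (b::'k)"
proof -
  obtain f where f: "inj_on f A" "f ` A \<subseteq> (UNIV::'k set)"
    using assms unfolding lesspoll_def lepoll_def by blast
  obtain b where "\<forall>a\<in>A. f a < b" using wc_bound[OF assms] by blast
  then have "A \<lesssim> oseg b" unfolding lepoll_def using f by (intro exI[of _ f]) auto
  then show ?thesis by blast
qed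

text \<open>By regularity the thresholds of fewer than \<kappa> coordinates have a common
  bound.\<close>

lemma settles_uniformly:
  assumes "A \<prec> (UNIV::'k set)" "\<forall>x\<in>A. settles (H::'k set) (\<lambda>d. F d x)"
  shows "\<exists>v b. \<forall>x\<in>A. \<forall>d\<in>H. b \<le> d \<longrightarrow> F d x = v x"
proof -
  have "\<forall>x\<in>A. \<exists>v n. \<forall>d\<in>H. n \<le> d \<longrightarrow> F d x = v"
    using assms(2) unfolding settles_def .
  from bchoice[OF this] obtain v where "\<forall>x\<in>A. \<exists>n. \<forall>d\<in>H. n \<le> d \<longrightarrow> F d x = v x" by blast
  from bchoice[OF this] obtain n where vn: "\<forall>x\<in>A. \<forall>d\<in>H. n x \<le> d \<longrightarrow> F d x = v x" by blast
  obtain b where "\<forall>x\<in>A. n x < b" using wc_bound[OF assms(1)] by blast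
  then have "\<forall>x\<in>A. \<forall>d\<in>H. b \<le> d \<longrightarrow> F d x = v x"
    using vn by (meson less_imp_le order_trans)
  then show ?thesis by blast
qed

text \<open>Sierpinski's colouring: a homogeneous set for the lexicographic order is monotone, and
  monotone sequences in a power of 2 stabilise coordinate by coordinate.\<close>
lemma wc_converge_UNIV:
  fixes F :: "'k \<Rightarrow> 'k \<Rightarrow> bool"
  shows "\<exists>H. unbdd H \<and> (\<forall>s. settles H (\<lambda>d. F d s))"
proof -
  define lex where "lex x y \<longleftrightarrow> F x = F y \<or> (\<exists>s. (\<forall>t<s. F x t = F y t) \<and> \<not> F x s \<and> F y s)" for x y
  have lexD: "F y s" if "lex x y" "\<forall>t<s. F x t = F y t" "F x s" for x y s
    using that unfolding lex_def by (metis linorder_neqE)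
  have lex_linear: "lex y x" if nl: "\<not> lex x y" for x y
  proof -
    have "\<exists>s. F x s \<noteq> F y s" using nl by (auto simp: lex_def)
    then obtain s where s: "F x s \<noteq> F y s" "\<forall>t<s. F x t = F y t"
      using exists_least_iff[of "\<lambda>s. F x s \<noteq> F y s"] by blast
    then have "\<not> F x s \<and> F y s \<Longrightarrow> lex x y" unfolding lex_def by blast
    then have "\<not> F y s \<and> F x s" using s(1) nl by blast
    moreover have "\<forall>t<s. F y t = F x t" using s(2) by simp
    ultimately show ?thesis unfolding lex_def by blast
  qed
  obtain H b where H: "unbdd H" "\<forall>x\<in>H. \<forall>y\<in>H. x < y \<longrightarrow> lex x y = b"
    using wc_partition[of lex] by blast
  have "settles H (\<lambda>d. F d s)" for s
  proof (induction s rule: less_induct)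
    case (less s)
    have "\<forall>t\<in>oseg s. settles H (\<lambda>d. F d t)" using less by simp
    then obtain v n where n: "\<forall>t\<in>oseg s. \<forall>d\<in>H. n \<le> d \<longrightarrow> F d t = v t"
      using settles_uniformly[OF wc_oseg[of s], of H F] by blast
    have agree: "\<forall>t<s. F x t = F y t" if "x \<in> H" "y \<in> H" "n \<le> x" "n \<le> y" for x y
      using n that by simp
    \<comment> \<open>Once the earlier coordinates are fixed, coordinate \<open>s\<close> can only
      move towards \<open>b\<close>: the sequence increases when \<open>b\<close> is true and
      decreases otherwise.\<close>
    define B where "B d = (F d s = b)" for d
    have mono: "B y" if "x \<in> H" "y \<in> H" "n \<le> x" "x < y" "B x" for x y
    proof (cases b)
      case True
      then show ?thesis using that lexD[of x y s] agree[of x y] H(2) by (auto simp: B_def)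
    next
      case False
      then have "lex y x" using lex_linear H(2) that by blast
      then show ?thesis using that lexD[of y x s] agree[of y x] False by (auto simp: B_def)
    qed
    show ?case
    proof (cases "\<exists>x\<in>H. n \<le> x \<and> B x")
      case True
      then obtain x where "x \<in> H" "n \<le> x" "B x" by blast
      then have "\<forall>d\<in>H. x \<le> d \<longrightarrow> F d s = b" using mono by (metis B_def le_less)
      then show ?thesis unfolding settles_def by blast
    next
      case False
      then have "\<forall>d\<in>H. n \<le> d \<longrightarrow> F d s = (\<not> b)" by (auto simp: B_def)
      then show ?thesis unfolding settles_def by blast
    qed
  qed
  then show ?thesis using H by blast
qed

lemma wc_converge:
  fixes F :: "'k \<Rightarrow> 'x \<Rightarrow> bool"
  assumes "X \<lesssim> (UNIV::'k set)"
  shows "\<exists>H. unbdd H \<and> (\<forall>x\<in>X. settles H (\<lambda>d. F d x))"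
proof -
  obtain e :: "'x \<Rightarrow> 'k" where e: "inj_on e X" using assms unfolding lepoll_def by blast
  obtain H where H: "unbdd H" "\<forall>s. settles H (\<lambda>d. \<exists>x\<in>X. e x = s \<and> F d x)"
    using wc_converge_UNIV[of "\<lambda>d s. \<exists>x\<in>X. e x = s \<and> F d x"] by blast
  have "settles H (\<lambda>d. F d x)" if "x \<in> X" for x
  proof -
    have "(\<lambda>d. \<exists>x'\<in>X. e x' = e x \<and> F d x') = (\<lambda>d. F d x)"
      using e that by (auto simp: inj_on_def)
    then show ?thesis using H(2)[rule_format, of "e x"] by simp
  qed
  then show ?thesis using H(1) by blast
qed

text \<open>Among \<kappa> many distinct subsets of \<open>oseg l\<close>, an unbounded family
  converges. Fewer than \<kappa> coordinates settle simultaneously, so two members coincide.\<close>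

lemma wc_Pow: "Pow (oseg (l::'k)) \<prec> (UNIV::'k set)"
proof (rule ccontr)
  assume "\<not> ?thesis"
  then have "(UNIV::'k set) \<lesssim> Pow (oseg l)" by (rule not_lesspoll_imp_lepoll)
  then obtain f :: "'k \<Rightarrow> 'k set" where f: "inj f" "\<And>d. f d \<subseteq> oseg l"
    unfolding lepoll_def by auto
  obtain H where H: "unbdd H" "\<forall>s. settles H (\<lambda>d. s \<in> f d)"
    using wc_converge_UNIV[of "\<lambda>d s. s \<in> f d"] by blast
  then have "\<forall>s\<in>oseg l. settles H (\<lambda>d. s \<in> f d)" by blast
  then obtain v b where vb: "\<forall>x\<in>oseg l. \<forall>d\<in>H. b \<le> d \<longrightarrow> (x \<in> f d) = v x"
    using settles_uniformly[OF wc_oseg[of l], of H "\<lambda>d s. s \<in> f d"] by blast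
  obtain d where d: "d \<in> H" "b < d" using H(1) unfolding unbdd_def by blast
  obtain d' where d': "d' \<in> H" "d < d'" using H(1) unfolding unbdd_def by blast
  have "x \<in> f d \<longleftrightarrow> x \<in> f d'" for x
    using vb[rule_format, of x d] vb[rule_format, of x d'] d d' f(2)[of d] f(2)[of d']
    by (cases "x \<in> oseg l") auto
  then have "f d = f d'" by blast
  then show False using f(1) d' by (auto simp: inj_def)
qed

text \<open>Closing the given functions under composition and passing to a convergent set makes
  eventual comparison well-founded. Pushing that set forward by a minimal unbounded
  composition makes it normal.\<close>
lemma wc_normal:
  assumes F: "F \<lesssim> (UNIV::'k set)" "\<And>f. f \<in> F \<Longrightarrow> regressive (f :: 'k \<Rightarrow> 'k)"
  shows "\<exists>H. unbdd H \<and> (\<forall>f\<in>F. settles H f)"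
proof -
  \<comment> \<open>\<open>G n\<close> holds the \<open>n\<close>-fold compositions of members of
    \<open>F\<close>.\<close>
  define G where "G = rec_nat {id :: 'k \<Rightarrow> 'k} (\<lambda>n A. (\<lambda>(f,g). f \<circ> g) ` (F \<times> A))"
  have G0: "G 0 = {id}" and GS: "G (Suc n) = (\<lambda>(f,g). f \<circ> g) ` (F \<times> G n)" for n
    by (simp_all add: G_def)
  have Gn: "G n \<lesssim> (UNIV::'k set)" for n
  proof (induction n)
    case 0 show ?case using finite_lepoll_infinite[OF wc_infinite, of "{id :: 'k \<Rightarrow> 'k}"] by (simp add: G0)
  next
    case (Suc n)
    then have "F \<times> G n \<lesssim> (UNIV::'k set)" using Times_lepoll_infinite[OF wc_infinite] F by blast
    then show ?case unfolding GS using image_lepoll lepoll_trans by blast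
  qed
  define GG where "GG = (\<Union>n. G n)"
  have "(UNIV::nat set) \<lesssim> (UNIV::'k set)" using wc_infinite infinite_le_lepoll by blast
  then have "GG \<lesssim> (UNIV::'k set)" unfolding GG_def using UN_lepoll_infinite[OF wc_infinite] Gn by blast
  then have X: "GG \<times> (UNIV::'k set) \<lesssim> (UNIV::'k set)"
    using Times_lepoll_infinite[OF wc_infinite] by blast
  \<comment> \<open>A composition \<open>g\<close> is coded by the truth values of
    \<open>g d = z\<close>, one coordinate for each pair of \<open>g\<close> and
    \<open>z\<close>.\<close>
  obtain H where H: "unbdd H" "\<forall>x\<in>GG \<times> (UNIV::'k set). settles H (\<lambda>d. fst x d = snd x)"
    using wc_converge[OF X, of "\<lambda>d x. fst x d = snd x"] by blast
  define unb where "unb g \<longleftrightarrow> (\<forall>z. \<exists>n. \<forall>d\<in>H. n \<le> d \<longrightarrow> z < g d)" for g :: "'k \<Rightarrow> 'k"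
  \<comment> \<open>If \<open>g\<close> does not tend to \<kappa> along \<open>H\<close>, it has
    values at most \<open>z\<close> arbitrarily late. The coordinates for all values up to
    \<open>z\<close> settle together, so one of these late values is eventually constant.\<close>
  have unbD: "settles H g" if g: "g \<in> GG" "\<not> unb g" for g
  proof -
    obtain z where z: "\<And>n. \<exists>d\<in>H. n \<le> d \<and> g d \<le> z" using g(2) unfolding unb_def by (meson not_less)
    obtain z' where z': "z < z'" using wc_gt by blast
    have "\<forall>x\<in>oseg z'. settles H (\<lambda>d. g d = x)" using H(2) g(1) by auto
    then obtain v b where vb: "\<forall>x\<in>oseg z'. \<forall>d\<in>H. b \<le> d \<longrightarrow> (g d = x) = v x"
      using settles_uniformly[OF wc_oseg[of z'], of H "\<lambda>d x. g d = x"] by blast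
    obtain d where d: "d \<in> H" "b \<le> d" "g d \<le> z" using z by blast
    then have gd: "g d \<in> oseg z'" using z' by simp
    then have "v (g d)" using vb d by blast
    then have "\<forall>d'\<in>H. b \<le> d' \<longrightarrow> g d' = g d" using vb gd by blast
    then show ?thesis unfolding settles_def by blast
  qed
  have comp: "f \<circ> g \<in> GG" if fg: "f \<in> F" "g \<in> GG" for f g
  proof -
    obtain n where "g \<in> G n" using fg(2) by (auto simp: GG_def)
    then have "f \<circ> g \<in> G (Suc n)" unfolding GS using fg(1) by (auto simp: image_iff)
    then show ?thesis unfolding GG_def by blast
  qed
  \<comment> \<open>Otherwise composing further and further gives countably many functions that are
    all eventually above the least point. By regularity they are so at one common \<open>d\<close>,
    where regressiveness makes their values descend forever.\<close>
  have "\<exists>g\<in>GG. unb g \<and> (\<forall>f\<in>F. \<not> unb (f \<circ> g))"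
  proof (rule ccontr)
    assume "\<not> ?thesis"
    then have n: "\<And>g. \<lbrakk>g \<in> GG; unb g\<rbrakk> \<Longrightarrow> \<exists>f\<in>F. unb (f \<circ> g)" by blast
    have "\<exists>gs. \<forall>n. (gs n \<in> GG \<and> unb (gs n)) \<and> (\<exists>f\<in>F. gs (Suc n) = f \<circ> gs n)"
    proof (rule dependent_nat_choice)
      have "id \<in> GG" using G0 unfolding GG_def by blast
      moreover have "unb id" unfolding unb_def id_apply using wc_gt by (meson less_le_trans)
      ultimately show "\<exists>x. x \<in> GG \<and> unb x" by blast
    next
      fix x :: "'k \<Rightarrow> 'k" assume x: "x \<in> GG \<and> unb x"
      then obtain f where "f \<in> F" "unb (f \<circ> x)" using n by blast
      then show "\<exists>y. (y \<in> GG \<and> unb y) \<and> (\<exists>f\<in>F. y = f \<circ> x)" using comp x by blast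
    qed
    then obtain gs where gs: "\<And>n. unb (gs n)" "\<And>n. \<exists>f\<in>F. gs (Suc n) = f \<circ> gs n" by blast
    define z0 where "z0 = (LEAST x::'k. True)"
    have "\<forall>n. \<exists>m. \<forall>d\<in>H. m \<le> d \<longrightarrow> z0 < gs n d" using gs(1) unfolding unb_def by blast
    from choice[OF this] obtain m where m: "\<forall>n. \<forall>d\<in>H. m n \<le> d \<longrightarrow> z0 < gs n d" by blast
    have "\<not> (UNIV::'k set) \<lesssim> (UNIV::nat set)"
      using wc_uncountable countable_lepoll[of "UNIV::nat set" "UNIV::'k set"] by auto
    then have "(UNIV::nat set) \<prec> (UNIV::'k set)" using not_lesspoll_imp_lepoll by blast
    then obtain b where b: "\<forall>n. m n < b" using wc_bound[of "UNIV::nat set" m] by blast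
    obtain d where d: "d \<in> H" "b < d" using H(1) unfolding unbdd_def by blast
    have dec: "gs (Suc n) d < gs n d" for n
    proof -
      have "z0 < gs n d" using m d b by (meson less_imp_le less_trans)
      moreover obtain f where "f \<in> F" "gs (Suc n) = f \<circ> gs n" using gs(2) by blast
      ultimately show ?thesis using F(2)[of f] by (auto simp: regressive_def)
    qed
    have "(LEAST v. v \<in> range (\<lambda>n. gs n d)) \<in> range (\<lambda>n. gs n d)"
      by (rule LeastI_ex) blast
    then obtain k where "(LEAST v. v \<in> range (\<lambda>n. gs n d)) = gs k d" by blast
    then show False using not_less_Least[of "gs (Suc k) d" "\<lambda>v. v \<in> range (\<lambda>n. gs n d)"] dec by auto
  qed
  then obtain g where g: "g \<in> GG" "unb g" "\<And>f. f \<in> F \<Longrightarrow> \<not> unb (f \<circ> g)" by blast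
  have "unbdd (g ` H)" unfolding unbdd_def
  proof
    fix a
    obtain n where n: "\<forall>d\<in>H. n \<le> d \<longrightarrow> a < g d" using g(2) unfolding unb_def by blast
    obtain d where "d \<in> H" "n < d" using H(1) unfolding unbdd_def by blast
    then show "\<exists>x\<in>g ` H. a < x" using n by auto
  qed
  moreover have "settles (g ` H) f" if f: "f \<in> F" for f
  proof -
    obtain v n where vn: "\<forall>d\<in>H. n \<le> d \<longrightarrow> f (g d) = v"
      using unbD[OF comp[OF f g(1)] g(3)[OF f]] unfolding settles_def by auto
    obtain b where b: "\<forall>d\<in>oseg n. g d < b" using wc_bound[OF wc_oseg[of n], of g] by blast
    have "\<forall>y\<in>g ` H. b \<le> y \<longrightarrow> f y = v"
      using vn b by (metis imageE leD linorder_not_less mem_oseg)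
    then show ?thesis unfolding settles_def by blast
  qed
  ultimately show ?thesis by blast
qed

lemma wc_inaccessible: "inaccessible_in (UNIV::'k set)"
  unfolding inaccessible_in_def
proof (intro conjI allI impI ballI)
  show "Pow (oseg b) \<prec> (UNIV::'k set)" for b :: 'k by (rule wc_Pow)
  fix C :: "'k set" assume C: "cofinal_in C UNIV"
  show "C \<approx> (UNIV::'k set)"
  proof (rule ccontr)
    assume "\<not> ?thesis"
    then have "C \<prec> (UNIV::'k set)" by (simp add: lesspoll_def subset_imp_lepoll)
    then obtain b where "\<forall>a\<in>C. a < b" using wc_bound[of C "\<lambda>a. a"] by blast
    then show False using cofinal_inD[OF C, of b] by (auto simp: not_less[symmetric])
  qed
qed (rule wc_uncountable)

text \<open>The small sets form an ideal, proper by normality, that contains almost all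
  non-inaccessibles. Were some stationary set to reflect at no inaccessible, the
  inaccessibles would be small as well.\<close>
definition small :: "'k set \<Rightarrow> bool" where
  "small X \<longleftrightarrow> (\<exists>F. F \<lesssim> (UNIV::'k set) \<and> (\<forall>f\<in>F. regressive f) \<and>
     (\<forall>H\<subseteq>X. unbdd H \<longrightarrow> (\<exists>f\<in>F. \<not> settles H f)))"

lemma settles_subset: "\<lbrakk>settles H g; H' \<subseteq> H\<rbrakk> \<Longrightarrow> settles H' g"
  unfolding settles_def by blast

text \<open>An unbounded subset of the union is unbounded in one part, and settling passes to
  subsets.\<close>

lemma small_Un:
  assumes "small X" "small Y" shows "small (X \<union> Y)"
proof -
  obtain F where F: "F \<lesssim> (UNIV::'k set)" "\<forall>f\<in>F. regressive f"
    "\<forall>H\<subseteq>X. unbdd H \<longrightarrow> (\<exists>f\<in>F. \<not> settles H f)" using assms(1) unfolding small_def by blast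
  obtain G where G: "G \<lesssim> (UNIV::'k set)" "\<forall>f\<in>G. regressive f"
    "\<forall>H\<subseteq>Y. unbdd H \<longrightarrow> (\<exists>f\<in>G. \<not> settles H f)" using assms(2) unfolding small_def by blast
  have "\<exists>f\<in>F \<union> G. \<not> settles H f" if H: "H \<subseteq> X \<union> Y" "unbdd H" for H
  proof -
    have "unbdd (H \<inter> X) \<or> unbdd (H \<inter> Y)"
    proof (rule ccontr)
      assume "\<not> ?thesis"
      then obtain a b where ab: "\<forall>x\<in>H \<inter> X. \<not> a < x" "\<forall>x\<in>H \<inter> Y. \<not> b < x" unfolding unbdd_def by blast
      obtain x where "x \<in> H" "max a b < x" using H(2) unfolding unbdd_def by blast
      then show False using ab H(1) by auto
    qed
    then show ?thesis using F(3) G(3) settles_subset[of H _ "H \<inter> X"] settles_subset[of H _ "H \<inter> Y"]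
      by (meson Int_lower1 Int_lower2 UnI1 UnI2)
  qed
  moreover have "F \<union> G \<lesssim> (UNIV::'k set)" using Un_lepoll_infinite[OF wc_infinite F(1) G(1)] .
  ultimately show ?thesis unfolding small_def using F(2) G(2) by (intro exI[of _ "F \<union> G"]) blast
qed

lemma not_small_UNIV: "\<not> small UNIV"
proof
  assume "small UNIV"
  then obtain F :: "('k \<Rightarrow> 'k) set" where F: "F \<lesssim> (UNIV::'k set)" "\<forall>f\<in>F. regressive f"
    "\<forall>H\<subseteq>UNIV. unbdd H \<longrightarrow> (\<exists>f\<in>F. \<not> settles H f)" unfolding small_def by blast
  obtain H where "unbdd H" "\<forall>f\<in>F. settles H f" using wc_normal[OF F(1)] F(2) by blast
  then show False using F(3) by blast
qed

lemma small_bounded: "small {..a}"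
proof -
  have "\<not> unbdd H" if "H \<subseteq> {..a}" for H
    using that unfolding unbdd_def by (meson atMost_iff not_less subsetD)
  then show ?thesis unfolding small_def by (intro exI[of _ "{}"]) auto
qed

section \<open>Almost all non-inaccessibles form a small set\<close>

lemma regressive_if:
  assumes "\<And>d. Q d \<Longrightarrow> f d < d"
  shows "regressive (\<lambda>d. if Q d then f d else (LEAST x::'k. True))"
  unfolding regressive_def
proof (intro allI impI)
  fix d :: 'k assume "\<exists>z. z < d"
  then obtain z where "z < d" by blast
  then have "(LEAST x::'k. True) < d" using Least_le[of "\<lambda>_. True" z] by simp
  then show "(if Q d then f d else (LEAST x::'k. True)) < d" using assms by simp
qed

text \<open>Let \<open>g\<close> choose the witness \<open>b\<close> for each \<open>d\<close>. A
  constant value \<open>v\<close> on an unbounded set would embed every segment of \<kappa> into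
  \<open>Pow (oseg v)\<close>, contrary to \<open>wc_Pow\<close>.\<close>

lemma small_not_strong_limit: "small {d. \<exists>b<d. \<not> Pow (oseg b) \<prec> oseg d}" (is "small ?X")
proof -
  have "\<forall>d\<in>?X. \<exists>b. b < d \<and> \<not> Pow (oseg b) \<prec> oseg d" by blast
  from bchoice[OF this] obtain f where f: "\<forall>d\<in>?X. f d < d \<and> \<not> Pow (oseg (f d)) \<prec> oseg d" by blast
  define g where "g d = (if d \<in> ?X then f d else (LEAST x. True))" for d
  have g: "regressive g" unfolding g_def using f by (intro regressive_if) blast
  have "\<not> settles H g" if H: "H \<subseteq> ?X" "unbdd H" for H
  proof
    assume "settles H g"
    then obtain v n where vn: "\<forall>d\<in>H. n \<le> d \<longrightarrow> g d = v" unfolding settles_def by blast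
    have le: "oseg a \<lesssim> Pow (oseg v)" for a :: 'k
    proof -
      obtain d where d: "d \<in> H" "max a n < d" using H(2) unfolding unbdd_def by blast
      then have dX: "d \<in> ?X" using H(1) by blast
      then have "g d = f d" unfolding g_def by (rule if_P)
      then have "f d = v" using vn d by auto
      then have "\<not> Pow (oseg v) \<prec> oseg d" using f dX by blast
      then have "oseg d \<lesssim> Pow (oseg v)" by (rule not_lesspoll_imp_lepoll)
      moreover have "oseg a \<subseteq> oseg d" using d(2) by (intro oseg_subset) auto
      then have "oseg a \<lesssim> oseg d" by (rule subset_imp_lepoll)
      ultimately show ?thesis using lepoll_trans by blast
    qed
    \<comment> \<open>Two power sets are taken so that the segment \<open>oseg c\<close>, small by
      \<open>le\<close>, is large enough to contradict Cantor's theorem at \<open>b\<close>.\<close>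
    obtain b :: 'k where b: "Pow (oseg v) \<lesssim> oseg b" using lesspoll_imp_lepoll_oseg[OF wc_Pow[of v]] by blast
    obtain c :: 'k where c: "Pow (oseg b) \<lesssim> oseg c" using lesspoll_imp_lepoll_oseg[OF wc_Pow[of b]] by blast
    have "Pow (oseg b) \<lesssim> oseg b" by (rule lepoll_trans[OF lepoll_trans[OF c le[of c]] b])
    then show False using lesspoll_Pow_self[of "oseg b"] lesspoll_trans1 by blast
  qed
  moreover have "{g} \<lesssim> (UNIV::'k set)" by (intro finite_lepoll_infinite wc_infinite) simp
  ultimately show ?thesis unfolding small_def using g by (intro exI[of _ "{g}"]) blast
qed

text \<open>Here \<open>g\<close> settles the length of the chosen cofinal sequence and
  \<open>h x\<close> its term number \<open>x\<close>. Two members \<open>d < d'\<close> then share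
  one sequence, which stays below \<open>d\<close> and yet reaches \<open>d\<close>.\<close>

lemma small_singular:
  "small {d. \<exists>m<d. \<exists>e. (\<forall>x<m. e x < d) \<and> (\<forall>z<d. \<exists>x<m. z \<le> e x)}" (is "small ?X")
proof -
  have "\<forall>d\<in>?X. \<exists>m. m < d \<and> (\<exists>e. (\<forall>x<m. e x < d) \<and> (\<forall>z<d. \<exists>x<m. z \<le> e x))" by blast
  from bchoice[OF this] obtain m where
    m: "\<forall>d\<in>?X. m d < d \<and> (\<exists>e. (\<forall>x<m d. e x < d) \<and> (\<forall>z<d. \<exists>x<m d. z \<le> e x))" by blast
  then have "\<forall>d\<in>?X. \<exists>e. (\<forall>x<m d. e x < d) \<and> (\<forall>z<d. \<exists>x<m d. z \<le> e x)" by blast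
  from bchoice[OF this] obtain e where
    e: "\<forall>d\<in>?X. (\<forall>x<m d. e d x < d) \<and> (\<forall>z<d. \<exists>x<m d. z \<le> e d x)" by blast
  define g where "g d = (if d \<in> ?X then m d else (LEAST x. True))" for d
  define h where "h x d = (if d \<in> ?X \<and> x < m d then e d x else (LEAST x. True))" for x d
  have "regressive g" unfolding g_def using m by (intro regressive_if) blast
  moreover have "regressive (h x)" for x unfolding h_def using e by (intro regressive_if) blast
  moreover have "insert g (range h) \<lesssim> (UNIV::'k set)"
    using Un_lepoll_infinite[OF wc_infinite finite_lepoll_infinite[OF wc_infinite, of "{g}"] image_lepoll[of h UNIV]]
    by simp
  moreover have False if H: "H \<subseteq> ?X" "unbdd H" "settles H g" "\<forall>x. settles H (h x)" for H
  proof -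
    obtain \<mu> n where \<mu>: "\<forall>d\<in>H. n \<le> d \<longrightarrow> g d = \<mu>" using H(3) unfolding settles_def by blast
    have "\<forall>x\<in>oseg \<mu>. settles H (\<lambda>d. h x d)" using H(4) by simp
    then obtain v b where v: "\<forall>x\<in>oseg \<mu>. \<forall>d\<in>H. b \<le> d \<longrightarrow> h x d = v x"
      using settles_uniformly[OF wc_oseg[of \<mu>], of H "\<lambda>d x. h x d"] by blast
    have stable: "m d = \<mu> \<and> (\<forall>x<\<mu>. e d x = v x)" if "d \<in> H" "max n b < d" for d
    proof -
      have dX: "d \<in> ?X" using H(1) that by blast
      then have "g d = m d" unfolding g_def by (rule if_P)
      then have md: "m d = \<mu>" using \<mu> that by auto
      have "h x d = e d x" if "x < \<mu>" for x unfolding h_def using dX that md by (intro if_P) blast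
      moreover have "h x d = v x" if "x < \<mu>" for x using v \<open>d \<in> H\<close> \<open>max n b < d\<close> that by auto
      ultimately show ?thesis using md by simp
    qed
    obtain d where d: "d \<in> H" "max n b < d" using H(2) unfolding unbdd_def by blast
    obtain d' where d': "d' \<in> H" "d < d'" using H(2) unfolding unbdd_def by blast
    have X: "d \<in> ?X" "d' \<in> ?X" using H(1) d(1) d'(1) by blast+
    have st: "m d = \<mu> \<and> (\<forall>x<\<mu>. e d x = v x)" "m d' = \<mu> \<and> (\<forall>x<\<mu>. e d' x = v x)"
      using stable[OF d] stable[OF d'(1) less_trans[OF d(2) d'(2)]] .
    obtain x where x: "x < \<mu>" "d \<le> e d' x" using bspec[OF e X(2)] st(2) d'(2) by metis
    have "e d' x = e d x" using st x(1) by simp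
    moreover have "e d x < d" using bspec[OF e X(1)] st(1) x(1) by metis
    ultimately show False using x(2) by simp
  qed
  ultimately show ?thesis unfolding small_def by (intro exI[of _ "insert g (range h)"]) blast
qed

text \<open>Above a point \<open>a\<close> with infinite segment the strong limit property forces
  uncountability. A cofinal set smaller than \<open>d\<close> can be listed by some
  \<open>m < d\<close>, so excluding short cofinal sequences gives regularity.\<close>

lemma inaccessible_cases:
  obtains a where "\<And>d. \<lbrakk>a < d; \<not> (\<exists>b<d. \<not> Pow (oseg b) \<prec> oseg d);
      \<not> (\<exists>m<d. \<exists>e. (\<forall>x<m. e x < d) \<and> (\<forall>z<d. \<exists>x<m. z \<le> e x))\<rbrakk> \<Longrightarrow> strongly_inaccessible (d::'k)"
proof -
  obtain a :: 'k where a: "infinite (oseg a)"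
  proof (rule ccontr)
    assume "\<not> thesis"
    then have fin: "finite (oseg x)" for x :: 'k using that by blast
    have "inj (\<lambda>x::'k. card (oseg x))"
    proof (rule inj_onI)
      have "card (oseg x) < card (oseg y)" if "x < y" for x y :: 'k
        using that by (intro psubset_card_mono[OF fin]) (auto simp: psubset_eq)
      then show "x = y" if "card (oseg x) = card (oseg y)" for x y :: 'k
        using that by (metis less_irrefl linorder_neqE)
    qed
    then show False using wc_uncountable countableI' by blast
  qed
  show ?thesis
  proof (rule that[of a])
    fix d assume ad: "a < d" and sl: "\<not> (\<exists>b<d. \<not> Pow (oseg b) \<prec> oseg d)"
      and reg: "\<not> (\<exists>m<d. \<exists>e. (\<forall>x<m. e x < d) \<and> (\<forall>z<d. \<exists>x<m. z \<le> e x))"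
    have "\<not> countable (oseg d)"
    proof
      assume "countable (oseg d)"
      then have "countable (Pow (oseg a))"
        using sl ad countable_lesspoll by blast
      then have "Pow (oseg a) \<lesssim> (UNIV::nat set)" by (auto simp: countable_def lepoll_def)
      then have "Pow (oseg a) \<lesssim> oseg a" using a infinite_le_lepoll lepoll_trans by blast
      then show False using lesspoll_Pow_self[of "oseg a"] lesspoll_trans1 by blast
    qed
    moreover have "C \<approx> oseg d" if C: "cofinal_in C (oseg d)" for C
    proof (rule ccontr)
      assume "\<not> C \<approx> oseg d"
      then have Cd: "C \<prec> oseg d" using C by (simp add: lesspoll_def cofinal_in_def subset_imp_lepoll)
      have "\<exists>m<d. C \<lesssim> oseg m"
      proof (cases "finite C")
        case True
        then show ?thesis using finite_lepoll_infinite[OF a] ad by blast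
      next
        case False
        then obtain b where b: "b < d" "\<not> oseg b \<lesssim> C" using small_cofinal[OF _ C Cd] by blast
        then have "C \<lesssim> oseg b" using not_lesspoll_imp_lepoll lesspoll_imp_lepoll by blast
        then show ?thesis using b(1) by blast
      qed
      then obtain m e where m: "m < d" "C \<subseteq> e ` oseg m" unfolding lepoll_iff by blast
      obtain c where c: "c \<in> C" using cofinal_inD[OF C, of a] ad by auto
      \<comment> \<open>The listing may leave \<open>C\<close> at some indices; these are sent to a
        fixed point of \<open>C\<close> to keep the sequence below \<open>d\<close>.\<close>
      define e' where "e' x = (if e x \<in> C then e x else c)" for x
      have "\<forall>x<m. e' x < d" using C c by (auto simp: e'_def cofinal_in_def)
      moreover have "\<exists>x<m. z \<le> e' x" if zd: "z < d" for z
      proof -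
        obtain y where y: "y \<in> C" "z \<le> y" using cofinal_inD[OF C, of z] zd by auto
        then obtain x where "x < m" "y = e x" using m(2) by auto
        then show ?thesis using y by (intro exI[of _ x]) (simp add: e'_def)
      qed
      ultimately show False using reg m(1) by blast
    qed
    ultimately show "strongly_inaccessible d"
      using sl unfolding strongly_inaccessible_iff inaccessible_in_def by auto
  qed
qed

text \<open>Clubs \<open>C d\<close> avoiding \<open>S\<close> are guided by functions
  \<open>h y\<close>, which pick a point of \<open>C d\<close> at or above \<open>y\<close>. If all
  of these settle along an unbounded \<open>H\<close>, the limit of the \<open>C d\<close> is a club
  of \<kappa> missing \<open>S\<close>.\<close>

lemma small_inaccessible_not_reflecting:
  assumes S: "\<not> nonstationary_in (UNIV::'k set) S"
    and C: "\<forall>d. strongly_inaccessible d \<longrightarrow> nonstationary_in (oseg d) (S \<inter> oseg d)"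
  shows "small {d. strongly_inaccessible d}" (is "small ?X")
proof -
  have "\<forall>d\<in>?X. \<exists>C. club_in (oseg d) C \<and> C \<inter> (S \<inter> oseg d) = {}"
    using C unfolding nonstationary_in_def by blast
  from bchoice[OF this] obtain C where C: "\<forall>d\<in>?X. club_in (oseg d) (C d) \<and> C d \<inter> (S \<inter> oseg d) = {}"
    by blast
  have "\<forall>y d. \<exists>c. d \<in> ?X \<and> y < d \<longrightarrow> c \<in> C d \<and> y \<le> c"
    using C club_inD(2) by (metis mem_oseg)
  then obtain f where f: "\<And>y d. \<lbrakk>d \<in> ?X; y < d\<rbrakk> \<Longrightarrow> f y d \<in> C d \<and> y \<le> f y d" by metis
  define h where "h y d = (if d \<in> ?X \<and> y < d then f y d else (LEAST x. True))" for y d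
  have "f y d < d" if "d \<in> ?X" "y < d" for y d
    using f[OF that] C that(1) club_inD(1) by (metis mem_oseg subsetD)
  then have "regressive (h y)" for y unfolding h_def by (intro regressive_if) blast
  moreover have "range h \<lesssim> (UNIV::'k set)" by (rule image_lepoll)
  moreover have False if H: "H \<subseteq> ?X" "unbdd H" "\<forall>y. settles H (h y)" for H
  proof -
    define E where "E = {c. \<exists>n. \<forall>d\<in>H. n \<le> d \<longrightarrow> c \<in> C d}"
    have "club_in UNIV E"
    proof (rule club_inI)
      fix y
      obtain c n where n: "\<forall>d\<in>H. n \<le> d \<longrightarrow> h y d = c" using H(3) unfolding settles_def by blast
      have *: "c \<in> C d \<and> y \<le> c" if "d \<in> H" "max n y < d" for d
      proof -
        have dX: "d \<in> ?X" using H(1) that by blast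
        then have "h y d = f y d" unfolding h_def using that by (intro if_P) simp
        then have "f y d = c" using n that by auto
        then show ?thesis using f[OF dX, of y] that by auto
      qed
      obtain n' where "max n y < n'" using wc_gt by blast
      then have "c \<in> E" unfolding E_def using * by (intro CollectI exI[of _ n']) (meson less_le_trans)
      moreover obtain d where "d \<in> H" "max n y < d" using H(2) unfolding unbdd_def by blast
      ultimately show "\<exists>c\<in>E. y \<le> c" using * by blast
    next
      fix y assume y: "is_limit y" "\<forall>z<y. \<exists>c\<in>E. z \<le> c \<and> c < y"
      have "\<forall>c\<in>E \<inter> oseg y. \<exists>n. \<forall>d\<in>H. n \<le> d \<longrightarrow> c \<in> C d" unfolding E_def by blast
      from bchoice[OF this] obtain n where n: "\<forall>c\<in>E \<inter> oseg y. \<forall>d\<in>H. n c \<le> d \<longrightarrow> c \<in> C d" by blast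
      have "E \<inter> oseg y \<lesssim> oseg y" by (intro subset_imp_lepoll) simp
      then have "E \<inter> oseg y \<prec> (UNIV::'k set)" using lesspoll_trans1[OF _ wc_oseg] by blast
      \<comment> \<open>Fewer than \<kappa> points of \<open>E\<close> lie below \<open>y\<close>,
        so beyond one threshold all of them belong to \<open>C d\<close>, and \<open>y\<close>
        follows because \<open>C d\<close> is closed.\<close>
      then obtain b where b: "\<forall>c\<in>E \<inter> oseg y. n c < b" using wc_bound[of "E \<inter> oseg y" n] by blast
      obtain b' where b': "max b y < b'" using wc_gt by blast
      have "y \<in> C d" if d: "d \<in> H" "b' \<le> d" for d
      proof (rule club_inD(3))
        show "club_in (oseg d) (C d)" using C d(1) H(1) by blast
        show "y \<in> oseg d" "is_limit y" using b' d(2) y(1) by auto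
        show "\<forall>z<y. \<exists>c\<in>C d. z \<le> c \<and> c < y"
        proof (intro allI impI)
          fix z assume "z < y"
          then obtain c where c: "c \<in> E" "z \<le> c" "c < y" using y(2) by blast
          have "n c < b" using b c by simp
          then have "n c \<le> d" using b' d(2) by auto
          then have "c \<in> C d" using n c d(1) by simp
          then show "\<exists>c\<in>C d. z \<le> c \<and> c < y" using c by blast
        qed
      qed
      then show "y \<in> E" unfolding E_def by blast
    qed simp
    moreover have "E \<inter> S = {}"
    proof (rule ccontr)
      assume "E \<inter> S \<noteq> {}"
      then obtain c n where c: "c \<in> S" "\<forall>d\<in>H. n \<le> d \<longrightarrow> c \<in> C d" unfolding E_def by blast
      obtain d where d: "d \<in> H" "max c n < d" using H(2) unfolding unbdd_def by blast
      then have "c \<in> C d \<inter> (S \<inter> oseg d)" using c by auto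
      then show False using C d(1) H(1) by blast
    qed
    ultimately show False using S unfolding nonstationary_in_def by blast
  qed
  ultimately show ?thesis unfolding small_def by (intro exI[of _ "range h"]) blast
qed

text \<open>Without reflection \<kappa> would be the union of four small sets, namely a bounded one,
  the non-strong-limits, the singular points and the inaccessibles.\<close>

theorem stationary_reflection:
  assumes "\<not> nonstationary_in (UNIV::'k set) S"
  shows "\<exists>d. strongly_inaccessible d \<and> \<not> nonstationary_in (oseg d) (S \<inter> oseg d)"
proof (rule ccontr)
  assume "\<not> ?thesis"
  then have 1: "small {d::'k. strongly_inaccessible d}"
    using small_inaccessible_not_reflecting[OF assms] by blast
  obtain a where a: "\<And>d. \<lbrakk>a < d; \<not> (\<exists>b<d. \<not> Pow (oseg b) \<prec> oseg d);
      \<not> (\<exists>m<d. \<exists>e. (\<forall>x<m. e x < d) \<and> (\<forall>z<d. \<exists>x<m. z \<le> e x))\<rbrakk> \<Longrightarrow> strongly_inaccessible (d::'k)"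
    using inaccessible_cases by blast
  have eq: "({..a} \<union> {d. \<exists>b<d. \<not> Pow (oseg b) \<prec> oseg d}) \<union>
    ({d. \<exists>m<d. \<exists>e. (\<forall>x<m. e x < d) \<and> (\<forall>z<d. \<exists>x<m. z \<le> e x)} \<union> {d::'k. strongly_inaccessible d}) = UNIV"
    (is "?A = UNIV")
  proof (intro set_eqI iffI UNIV_I)
    fix d :: 'k
    show "d \<in> ?A" using a[of d] unfolding Un_iff mem_Collect_eq atMost_iff not_less[symmetric] by blast
  qed
  have "small ?A" by (intro small_Un small_bounded small_not_strong_limit small_singular 1)
  then have "small (UNIV::'k set)" unfolding eq .
  then show False using not_small_UNIV by blast
qed

text \<open>A club meets every club, so it is stationary and reflects at some inaccessible
  \<open>d\<close>. It is then unbounded in \<open>d\<close> and contains \<open>d\<close>.\<close>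

lemma inaccessible_in_club:
  assumes "club_in (UNIV::'k set) C" shows "\<exists>d\<in>C. strongly_inaccessible d"
proof -
  note u = inaccessible_in_uncountable_cof[OF wc_inaccessible]
  have "\<not> nonstationary_in (UNIV::'k set) C"
  proof
    assume "nonstationary_in (UNIV::'k set) C"
    then obtain E where E: "club_in UNIV E" "E \<inter> C = {}" unfolding nonstationary_in_def by blast
    then show False using club_inD(2)[OF club_in_Int[OF down_UNIV u E(1) assms]] by blast
  qed
  then obtain d where d: "strongly_inaccessible d" "\<not> nonstationary_in (oseg d) (C \<inter> oseg d)"
    using stationary_reflection by blast
  have ud: "uncountable_cof (oseg d)"
    using d(1) by (simp add: strongly_inaccessible_iff inaccessible_in_uncountable_cof)
  have "\<exists>c\<in>C. z \<le> c \<and> c < d" if z: "z < d" for z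
  proof (rule ccontr)
    assume "\<not> ?thesis"
    then have "{y \<in> oseg d. z < y} \<inter> (C \<inter> oseg d) = {}" by (auto dest: less_imp_le)
    then show False using d(2) club_in_tail[OF ud, of z] z unfolding nonstationary_in_def by auto
  qed
  then have "d \<in> C" using club_inD(3)[OF assms, of d] strongly_inaccessible_limit[OF d(1)] by blast
  then show ?thesis using d(1) by blast
qed

end

section \<open>Reflection of predense sets\<close>

text \<open>There are only \<kappa> many nodes, so along some unbounded set the membership of each
  of them settles. Fewer than \<kappa> nodes lie up to a given level, so these settle
  simultaneously.\<close>

lemma coherent_limit:
  fixes Q :: "'k::wellorder \<Rightarrow> 'k node set"
  assumes wc: "weakly_compact TYPE('k)" and U: "unbdd U"
  shows "\<exists>q\<subseteq>nodes UNIV. \<forall>y. \<exists>d\<in>U. y < d \<and> agree y q (Q d)"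
proof -
  have "\<forall>a. \<exists>d. d \<in> U \<and> a < d" using U unfolding unbdd_def by blast
  from choice[OF this] obtain u where u: "\<forall>a. u a \<in> U \<and> a < u a" by blast
  obtain H where H: "unbdd H" "\<forall>\<eta>\<in>nodes UNIV. settles H (\<lambda>a. \<eta> \<in> Q (u a))"
    using wc_converge[OF wc nodes_lepoll[OF wc_inaccessible[OF wc] down_UNIV], of "\<lambda>a \<eta>. \<eta> \<in> Q (u a)"]
    by blast
  define q where "q = {\<eta> \<in> nodes UNIV. \<exists>n. \<forall>a\<in>H. n \<le> a \<longrightarrow> \<eta> \<in> Q (u a)}"
  have "\<exists>d\<in>U. y < d \<and> agree y q (Q d)" for y
  proof -
    let ?X = "{\<eta> \<in> nodes UNIV. fst \<eta> \<le> y}"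
    have "?X \<prec> (UNIV::'k set)" by (rule nodes_upto_lesspoll[OF wc_inaccessible[OF wc]]) simp_all
    moreover have "\<forall>\<eta>\<in>?X. settles H (\<lambda>a. \<eta> \<in> Q (u a))" using H(2) by blast
    ultimately obtain v b where v: "\<forall>\<eta>\<in>?X. \<forall>a\<in>H. b \<le> a \<longrightarrow> (\<eta> \<in> Q (u a)) = v \<eta>"
      using settles_uniformly[OF wc, of ?X H "\<lambda>a \<eta>. \<eta> \<in> Q (u a)"] by blast
    obtain a where a: "a \<in> H" "max b y < a" using H(1) unfolding unbdd_def by blast
    have "\<eta> \<in> q \<longleftrightarrow> v \<eta>" if \<eta>: "\<eta> \<in> ?X" for \<eta>
    proof
      assume "\<eta> \<in> q"
      then obtain n where n: "\<forall>a\<in>H. n \<le> a \<longrightarrow> \<eta> \<in> Q (u a)" unfolding q_def by blast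
      obtain c where "c \<in> H" "max b n < c" using H(1) unfolding unbdd_def by blast
      then have "c \<in> H" "b \<le> c" "n \<le> c" by auto
      then show "v \<eta>" using n v \<eta> by blast
    next
      assume "v \<eta>"
      then show "\<eta> \<in> q" using v \<eta> unfolding q_def by blast
    qed
    moreover have "\<eta> \<in> Q (u a) \<longleftrightarrow> v \<eta>" if \<eta>: "\<eta> \<in> ?X" for \<eta>
      using bspec[OF bspec[OF v \<eta>] a(1)] a(2) by auto
    ultimately have "agree y q (Q (u a))" unfolding agree_def by blast
    moreover have "y < u a" using u[rule_format, of a] a(2) by auto
    ultimately show ?thesis using u by blast
  qed
  moreover have "q \<subseteq> nodes UNIV" unfolding q_def by blast
  ultimately show ?thesis by blast
qed

text \<open>Stationary reflection is what makes the gap levels of the limit nonstationary in the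
  whole of \<open>\<kappa>\<close>; everything else is local.\<close>
lemma cond_limit:
  fixes q :: "'k::wellorder node set"
  assumes wc: "weakly_compact TYPE('k)" and q: "q \<subseteq> nodes UNIV"
    and U: "\<And>d. d \<in> U \<Longrightarrow> cond (oseg d) (Q d) \<and> trunk (Q d) \<tau>"
    and lim: "\<forall>y. \<exists>d\<in>U. y < d \<and> agree y q (Q d)"
  shows "cond UNIV q" "trunk q \<tau>"
proof -
  \<comment> \<open>Both \<open>q\<close> and \<open>Q d\<close> consist of nodes, so agreement
    extends to arbitrary pairs and no membership in \<open>nodes\<close> has to be checked
    below.\<close>
  have L: "\<exists>d\<in>U. y < d \<and> agree y q (Q d) \<and> (\<forall>\<eta>. fst \<eta> \<le> y \<longrightarrow> (\<eta> \<in> q \<longleftrightarrow> \<eta> \<in> Q d))" for y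
  proof -
    obtain d where d: "d \<in> U" "y < d" "agree y q (Q d)" using lim by blast
    have "Q d \<subseteq> nodes (oseg d)" using U[OF d(1)] by (simp add: cond_def tree_def)
    then have "Q d \<subseteq> nodes UNIV" using nodes_mono[of "oseg d" UNIV] by blast
    then show ?thesis using d q unfolding agree_def by blast
  qed
  show t: "trunk q \<tau>"
  proof (rule trunkI)
    show "\<tau> \<in> q" using L[of "fst \<tau>"] U trunk_mem by blast
  next
    fix \<nu> assume \<nu>: "\<nu> \<in> q" "extn \<nu> False \<in> q" "extn \<nu> True \<in> q"
    let ?y = "max (fst \<nu>) (fst (extn \<nu> False))"
    obtain d where d: "d \<in> U" "\<forall>\<eta>. fst \<eta> \<le> ?y \<longrightarrow> (\<eta> \<in> q \<longleftrightarrow> \<eta> \<in> Q d)" using L by blast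
    have "fst (extn \<nu> True) = fst (extn \<nu> False)" by (simp add: fst_extn)
    then have "fst \<nu> \<le> ?y" "fst (extn \<nu> False) \<le> ?y" "fst (extn \<nu> True) \<le> ?y" by simp_all
    then have "\<nu> \<in> Q d" "extn \<nu> False \<in> Q d" "extn \<nu> True \<in> Q d" using d(2) \<nu> by blast+
    then show "initseg \<tau> \<nu>" using trunk_least[OF conjunct2[OF U[OF d(1)]]] by blast
  next
    fix \<eta> b assume \<eta>: "\<eta> \<in> q" "initseg \<tau> \<eta>"
    let ?y = "max (fst \<eta>) (fst (extn \<eta> b))"
    obtain d where d: "d \<in> U" "\<forall>\<eta>. fst \<eta> \<le> ?y \<longrightarrow> (\<eta> \<in> q \<longleftrightarrow> \<eta> \<in> Q d)" using L by blast
    have y: "fst \<eta> \<le> ?y" "fst (extn \<eta> b) \<le> ?y" by simp_all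
    then have "\<eta> \<in> Q d" using d(2) \<eta>(1) by blast
    then have "extn \<eta> b \<in> Q d" using trunk_extn[OF conjunct2[OF U[OF d(1)]]] \<eta>(2) by blast
    then show "extn \<eta> b \<in> q" using d(2) y(2) by blast
  qed
  have "restr (snd \<eta>) s \<in> q" if \<eta>: "\<eta> \<in> q" "s \<le> fst \<eta>" for \<eta> s
  proof -
    obtain d where d: "d \<in> U" "\<forall>\<nu>. fst \<nu> \<le> fst \<eta> \<longrightarrow> (\<nu> \<in> q \<longleftrightarrow> \<nu> \<in> Q d)" using L by blast
    have td: "tree (oseg d) (Q d)" using U[OF d(1)] by (simp add: cond_def)
    have "\<eta> \<in> Q d" using d(2) \<eta>(1) by blast
    then have "restr (snd \<eta>) s \<in> Q d" using treeD[OF td] \<eta>(2) by blast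
    then show ?thesis using d(2)[rule_format, of "restr (snd \<eta>) s"] \<eta>(2) by simp
  qed
  then have "tree UNIV q" unfolding tree_def using q by blast
  moreover have g: "\<exists>d. cond (oseg d) (Q d) \<and> y < d \<and> (\<forall>e\<le>y. gap q e = gap (Q d) e \<and> (e \<in> gaps UNIV q \<longleftrightarrow> e \<in> gaps (oseg d) (Q d)))" for y
  proof -
    obtain d where d: "d \<in> U" "y < d" "agree y q (Q d)" using lim by blast
    then show ?thesis
      using U[OF d(1)] gap_agree[OF d(3)] by (intro exI[of _ d]) (auto simp: gaps_def)
  qed
  have "gaps UNIV q \<subseteq> S_inc UNIV"
  proof
    fix e assume e: "e \<in> gaps UNIV q"
    obtain d where "cond (oseg d) (Q d)" "e \<in> gaps (oseg d) (Q d)" using g[of e] e by blast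
    then show "e \<in> S_inc UNIV" unfolding cond_def S_inc_def by auto
  qed
  moreover have "\<forall>e\<in>gaps UNIV q. gap q e \<in> idQ e"
  proof
    fix e assume e: "e \<in> gaps UNIV q"
    obtain d where "cond (oseg d) (Q d)" "e \<in> gaps (oseg d) (Q d)" "gap q e = gap (Q d) e"
      using g[of e] e by blast
    then show "gap q e \<in> idQ e" unfolding cond_def by auto
  qed
  moreover have "nowhere_stationary UNIV (gaps UNIV q)"
  proof -
    \<comment> \<open>Up to \<open>a\<close> the gap levels of \<open>q\<close> are those of a
      single \<open>Q d\<close> with \<open>a < d\<close>. Only \<kappa> itself then remains, which
      is where reflection enters.\<close>
    have below: "nonstationary_in (oseg a) (gaps UNIV q \<inter> oseg a)" if u: "uncountable_cof (oseg a)" for a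
    proof -
      obtain d where d: "cond (oseg d) (Q d)" "a < d"
        and eq: "\<forall>e\<le>a. e \<in> gaps UNIV q \<longleftrightarrow> e \<in> gaps (oseg d) (Q d)" using g[of a] by blast
      have "gaps UNIV q \<inter> oseg a = gaps (oseg d) (Q d) \<inter> oseg a" using eq by auto
      moreover have "nowhere_stationary (oseg d) (gaps (oseg d) (Q d))" using d(1) by (simp add: cond_def)
      ultimately show ?thesis using u d(2) unfolding nowhere_stationary_def by auto
    qed
    moreover have "nonstationary_in UNIV (gaps UNIV q)"
    proof (rule ccontr)
      assume "\<not> ?thesis"
      then obtain d where d: "strongly_inaccessible d" "\<not> nonstationary_in (oseg d) (gaps UNIV q \<inter> oseg d)"
        using stationary_reflection[OF wc] by blast
      then show False
        using below[OF inaccessible_in_uncountable_cof] by (simp add: strongly_inaccessible_iff)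
    qed
    ultimately show ?thesis unfolding nowhere_stationary_def by auto
  qed
  ultimately show "cond UNIV q" using t unfolding cond_def by blast
qed

text \<open>Fixing the trunk makes the limit of the counterexamples a condition with that trunk.
  Some \<open>p\<close> in \<open>A\<close> is compatible with it, and this is decided at the levels
  of the two trunks, where the limit agrees with some \<open>Q d\<close>.\<close>

lemma predense_reflects_trunk:
  fixes t :: "'k::wellorder node set \<Rightarrow> 'k node"
  assumes wc: "weakly_compact TYPE('k)" and A: "predense (Qset UNIV idQ) A"
    and t: "\<And>p. p \<in> A \<Longrightarrow> trunk p (t p)"
  shows "\<not> unbdd {d. strongly_inaccessible d \<and> (\<exists>q. cond (oseg d) q \<and> trunk q \<tau> \<and>
    (\<forall>p\<in>A. fst (t p) < d \<longrightarrow> \<not> compatible (Qset (oseg d) idQ) (p \<inter> nodes (oseg d)) q))}"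
    (is "\<not> unbdd ?U")
proof
  assume U: "unbdd ?U"
  have "\<forall>d\<in>?U. \<exists>q. cond (oseg d) q \<and> trunk q \<tau> \<and>
    (\<forall>p\<in>A. fst (t p) < d \<longrightarrow> \<not> compatible (Qset (oseg d) idQ) (p \<inter> nodes (oseg d)) q)" by blast
  from bchoice[OF this] obtain Q where Q: "\<forall>d\<in>?U. cond (oseg d) (Q d) \<and> trunk (Q d) \<tau> \<and>
    (\<forall>p\<in>A. fst (t p) < d \<longrightarrow> \<not> compatible (Qset (oseg d) idQ) (p \<inter> nodes (oseg d)) (Q d))" by blast
  obtain q where q: "q \<subseteq> nodes UNIV" "\<forall>y. \<exists>d\<in>?U. y < d \<and> agree y q (Q d)"
    using coherent_limit[OF wc U, of Q] by blast
  have cq: "cond UNIV q" "trunk q \<tau>"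
    using cond_limit[OF wc q(1), of ?U Q \<tau>] Q q(2) by blast+
  obtain p where p: "p \<in> A" "compatible (Qset UNIV idQ) p q"
    using A cq(1) unfolding predense_def Qset_iff_cond[symmetric] by blast
  have cp: "cond UNIV p" using A p(1) unfolding predense_def by (auto simp: Qset_iff_cond)
  have comp: "initseg (t p) \<tau> \<and> \<tau> \<in> p \<or> initseg \<tau> (t p) \<and> t p \<in> q"
    using compatible_iff[OF down_UNIV cp t[OF p(1)] cq] p(2) by blast
  obtain d where d: "d \<in> ?U" "max (fst \<tau>) (fst (t p)) < d" "agree (max (fst \<tau>) (fst (t p))) q (Q d)"
    using q(2) by blast
  have ld: "is_limit d" using d(1) strongly_inaccessible_limit by blast
  have td: "fst (t p) < d" "fst \<tau> < d" using d(2) by auto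
  have Qd: "cond (oseg d) (Q d)" "trunk (Q d) \<tau>" using Q d(1) by blast+
  note pd = cond_oseg[OF cp t[OF p(1)] ld td(1)]
  have "\<tau> \<in> nodes (oseg d)" using Qd trunk_mem[OF Qd(2)] by (auto simp: cond_def tree_def)
  moreover have "t p \<in> nodes UNIV" using cp trunk_mem[OF t[OF p(1)]] by (auto simp: cond_def tree_def)
  then have "t p \<in> q \<longleftrightarrow> t p \<in> Q d" using agreeD[OF d(3)] by simp
  ultimately have "initseg (t p) \<tau> \<and> \<tau> \<in> p \<inter> nodes (oseg d) \<or> initseg \<tau> (t p) \<and> t p \<in> Q d"
    using comp by blast
  then have "compatible (Qset (oseg d) idQ) (p \<inter> nodes (oseg d)) (Q d)"
    using compatible_iff[OF down_oseg pd Qd] by blast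
  then show False using Q d(1) p(1) td(1) by blast
qed

text \<open>For each trunk the bad levels are bounded by some \<open>\<beta> \<tau>\<close>. An
  inaccessible \<open>d\<close> closed under \<open>\<beta>\<close>, found in a diagonal
  intersection of tails, is bad for no trunk below \<open>d\<close>.\<close>

lemma predense_reflects:
  fixes t :: "'k::wellorder node set \<Rightarrow> 'k node"
  assumes wc: "weakly_compact TYPE('k)" and A: "predense (Qset UNIV idQ) A"
    and t: "\<And>p. p \<in> A \<Longrightarrow> trunk p (t p)"
  shows "unbdd {d. strongly_inaccessible d \<and>
    predense (Qset (oseg d) idQ) ((\<lambda>p. p \<inter> nodes (oseg d)) ` {p \<in> A. fst (t p) < d})}"
  unfolding unbdd_def
proof
  fix a :: 'k
  define bad where "bad \<tau> d \<longleftrightarrow> strongly_inaccessible d \<and> (\<exists>q. cond (oseg d) q \<and> trunk q \<tau> \<and>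
    (\<forall>p\<in>A. fst (t p) < d \<longrightarrow> \<not> compatible (Qset (oseg d) idQ) (p \<inter> nodes (oseg d)) q))" for \<tau> d
  note inacc = wc_inaccessible[OF wc]
  note u = inaccessible_in_uncountable_cof[OF inacc]
  have "\<not> unbdd {d. bad \<tau> d}" for \<tau>
    unfolding bad_def by (rule predense_reflects_trunk[OF wc A t])
  then have "\<exists>b. \<forall>d. bad \<tau> d \<longrightarrow> d \<le> b" for \<tau>
    unfolding unbdd_def by (simp add: not_less)
  then have "\<forall>\<tau>. \<exists>b. \<forall>d. bad \<tau> d \<longrightarrow> d \<le> b" by blast
  from choice[OF this] obtain \<beta> where \<beta>: "\<forall>\<tau> d. bad \<tau> d \<longrightarrow> d \<le> \<beta> \<tau>" by blast
  have "club_in UNIV {y \<in> UNIV. \<forall>\<tau>\<in>nodes UNIV. fst \<tau> < y \<longrightarrow> y \<in> {y \<in> UNIV. \<beta> \<tau> < y}}"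
  proof (rule club_in_diagonal[OF down_UNIV u])
    show "club_in UNIV {y \<in> UNIV. \<beta> \<tau> < y}" for \<tau> by (rule club_in_tail[OF u]) simp
  next
    fix \<tau> :: "'k node" and u assume "fst \<tau> < u" "is_limit u"
    then show "\<exists>z<u. fst \<tau> < z" by (auto simp: is_limit_def)
  next
    fix y :: 'k and g :: "'k node \<Rightarrow> 'k"
    have "{\<eta> \<in> nodes UNIV. fst \<eta> \<le> y} \<prec> (UNIV::'k set)"
      by (rule nodes_upto_lesspoll[OF inacc]) simp_all
    then obtain b where "\<forall>\<eta>\<in>{\<eta> \<in> nodes UNIV. fst \<eta> \<le> y}. g \<eta> < b" using wc_bound[OF wc] by blast
    then show "\<exists>b\<in>UNIV. \<forall>\<tau>\<in>nodes UNIV. fst \<tau> < y \<longrightarrow> g \<tau> \<le> b" by (auto intro!: exI[of _ b] less_imp_le)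
  qed auto
  from club_in_Int[OF down_UNIV u this club_in_tail[OF u UNIV_I[of a]]]
  obtain d where d: "strongly_inaccessible d" "a < d" "\<forall>\<tau>\<in>nodes UNIV. fst \<tau> < d \<longrightarrow> \<beta> \<tau> < d"
    using inaccessible_in_club[OF wc] by blast
  have "predense (Qset (oseg d) idQ) ((\<lambda>p. p \<inter> nodes (oseg d)) ` {p \<in> A. fst (t p) < d})"
    unfolding predense_def
  proof (intro conjI subsetI ballI)
    fix r assume "r \<in> (\<lambda>p. p \<inter> nodes (oseg d)) ` {p \<in> A. fst (t p) < d}"
    then obtain p where p: "p \<in> A" "fst (t p) < d" "r = p \<inter> nodes (oseg d)" by blast
    have "cond UNIV p" using A p(1) unfolding predense_def by (auto simp: Qset_iff_cond)
    then show "r \<in> Qset (oseg d) idQ"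
      using cond_oseg(1)[OF _ t[OF p(1)] strongly_inaccessible_limit[OF d(1)] p(2)] p(3)
      by (simp add: Qset_iff_cond)
  next
    fix q assume "q \<in> Qset (oseg d) idQ"
    then have q: "cond (oseg d) q" by (simp add: Qset_iff_cond)
    then obtain \<tau> where \<tau>: "trunk q \<tau>" unfolding cond_def by blast
    have "\<tau> \<in> nodes (oseg d)" using q trunk_mem[OF \<tau>] by (auto simp: cond_def tree_def)
    then have "\<tau> \<in> nodes UNIV" "fst \<tau> < d" using nodes_mono[of "oseg d" UNIV] nodesD[of \<tau> "oseg d"] by auto
    then have "\<not> bad \<tau> d" using \<beta> d(3) by (meson not_less)
    then show "\<exists>p\<in>(\<lambda>p. p \<inter> nodes (oseg d)) ` {p \<in> A. fst (t p) < d}. compatible (Qset (oseg d) idQ) p q"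
      using q \<tau> d(1) unfolding bad_def by blast
  qed
  then show "\<exists>x\<in>{d. strongly_inaccessible d \<and> predense (Qset (oseg d) idQ)
      ((\<lambda>p. p \<inter> nodes (oseg d)) ` {p \<in> A. fst (t p) < d})}. a < x"
    using d(1,2) by blast
qed

text \<open>Along a branch, being in \<open>p\<close> can only be lost at a gap of \<open>p\<close>.\<close>
lemma branch_step:
  assumes p: "cond UNIV p" "trunk p \<tau>" and x: "\<forall>s<d. restr x s \<in> p" and d: "fst \<tau> < d"
    and avoid: "\<And>e. \<lbrakk>d \<le> e; e \<in> gaps UNIV p\<rbrakk> \<Longrightarrow> snd (restr x e) \<notin> gap p e"
  shows "restr x s \<in> p"
proof (induction s rule: less_induct)
  case (less s)
  show ?case
  proof (cases "s < d")
    case True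
    then show ?thesis using x by blast
  next
    case False
    then have ds: "d \<le> s" by simp
    show ?thesis
    proof (cases "is_limit s")
      case True
      show ?thesis
      proof (rule ccontr)
        assume n: "restr x s \<notin> p"
        have "restr (snd (restr x s)) r = restr x r" if "r < s" for r
          using that by (intro restr_restr) simp
        moreover have "restr x s = (s, snd (restr x s))" by (simp add: prod_eq_iff)
        ultimately have g: "snd (restr x s) \<in> gap p s"
          unfolding gap_def using n less snd_restr_funs by auto
        then have "s \<in> gaps UNIV p" using True unfolding gaps_def by blast
        then show False using avoid[OF ds] g by blast
      qed
    next
      case False
      have "fst \<tau> < s" using d ds by simp
      then obtain r where r: "r < s" "\<forall>w. r < w \<longrightarrow> s \<le> w" 
        using False unfolding is_limit_def by (meson not_less)
      have "(LEAST z. r < z) = s" using r by (intro Least_equality) auto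
      then have e: "extn (restr x r) (x r) = restr x s" using extn_restr[OF r(1), of x] by simp
      have rp: "restr x r \<in> p" using less r(1) by blast
      have "fst \<tau> \<le> r" using r(2) \<open>fst \<tau> < s\<close> by (meson not_le)
      moreover have "initseg \<tau> (restr x r) \<or> initseg (restr x r) \<tau>"
        using trunk_comparable[OF _ p(2) rp] p(1) by (auto simp: cond_def)
      ultimately have "initseg \<tau> (restr x r)" unfolding initseg_def by auto
      then show ?thesis using trunk_extn[OF p(2) rp, of "x r"] e by simp
    qed
  qed
qed

lemma wid_subset_id_minus:
  assumes wc: "weakly_compact TYPE('k::wellorder)"
  shows "(wid :: ('k \<Rightarrow> bool) set set) \<subseteq> id_minus"
proof
  fix X :: "('k \<Rightarrow> bool) set" assume "X \<in> wid"
  then obtain A where X: "X \<subseteq> funs UNIV" and A: "max_antichain (Qset UNIV idQ) A" and XA: "X \<subseteq> set0 UNIV A"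
    unfolding wid_def QK_def by blast
  have cA: "cond UNIV p" if "p \<in> A" for p
    using A that unfolding max_antichain_def by (auto simp: Qset_iff_cond)
  define t where "t p = (SOME \<tau>. trunk p \<tau>)" for p :: "'k node set"
  have t: "trunk p (t p)" if "p \<in> A" for p
  proof -
    have "\<exists>\<tau>. trunk p \<tau>" using cA[OF that] by (simp add: cond_def)
    then show ?thesis unfolding t_def by (rule someI_ex)
  qed
  have t_inj: "inj_on t A" by (rule trunk_injective[OF down_UNIV A t])
  have t_nodes: "t p \<in> nodes UNIV" if "p \<in> A" for p
    using cA[OF that] trunk_mem[OF t[OF that]] by (auto simp: cond_def tree_def)
  define R where "R = {d. strongly_inaccessible d \<and>
    predense (Qset (oseg d) idQ) ((\<lambda>p. p \<inter> nodes (oseg d)) ` {p \<in> A. fst (t p) < d})}"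
  have "predense (Qset UNIV idQ) A" using A unfolding predense_def max_antichain_def by blast
  then have R: "unbdd R" unfolding R_def by (rule predense_reflects[OF wc _ t])
  \<comment> \<open>Dropping the limit points of \<open>R\<close> makes the set nowhere stationary
    and keeps it unbounded.\<close>
  define T where "T = {d \<in> R. \<not> cofinal_in (R \<inter> oseg d) (oseg d)}"
  define S where "S = T \<union> {d. \<exists>p\<in>A. fst (t p) < d \<and> d \<in> gaps UNIV p}"
  \<comment> \<open>Only members of \<open>A\<close> with trunk below \<open>d\<close> contribute.
    There are at most \<open>oseg d\<close> many of them, so the union of their gaps stays in
    \<open>idQ d\<close>.\<close>
  define N where "N d = (\<Union>p\<in>{p \<in> A. fst (t p) < d}. gap p d) \<union>
    (if d \<in> T then set0 (oseg d) ((\<lambda>p. p \<inter> nodes (oseg d)) ` {p \<in> A. fst (t p) < d}) else {})" for d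
  have T_unbdd: "\<exists>d\<in>T. a < d" for a
  proof -
    have "\<exists>d. d \<in> R \<and> a < d" using R unfolding unbdd_def by blast
    \<comment> \<open>The least element of \<open>R\<close> above \<open>a\<close> is not a limit of
      \<open>R\<close>, hence lies in \<open>T\<close>.\<close>
    then obtain d where d: "d \<in> R \<and> a < d" "\<forall>e<d. \<not> (e \<in> R \<and> a < e)"
      using exists_least_iff[of "\<lambda>d. d \<in> R \<and> a < d"] by blast
    have "is_limit d" using d(1) strongly_inaccessible_limit unfolding R_def by blast
    then obtain w where w: "a < w" "w < d" using d(1) by (auto simp: is_limit_def)
    have "\<not> cofinal_in (R \<inter> oseg d) (oseg d)"
      unfolding cofinal_in_Int_oseg using w d(2) by (meson less_le_trans)
    then show ?thesis using d(1) unfolding T_def by blast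
  qed
  have gaps_inc: "gaps UNIV p \<subseteq> S_inc UNIV" if "p \<in> A" for p using cA[OF that] by (simp add: cond_def)
  have S_inc: "S \<subseteq> S_inc UNIV"
    unfolding S_def T_def using gaps_inc by (auto simp: R_def S_inc_def)
  have "nowhere_stationary UNIV S"
    unfolding S_def
  proof (rule nowhere_stationary_Un[OF down_UNIV])
    show "nowhere_stationary UNIV T" unfolding T_def by (rule nowhere_stationary_discrete)
    show "nowhere_stationary UNIV {d. \<exists>p\<in>A. fst (t p) < d \<and> d \<in> gaps UNIV p}"
    proof (rule nowhere_stationary_diagonal[OF wc_inaccessible[OF wc]])
      show "nowhere_stationary UNIV (gaps UNIV p)" if "p \<in> A" for p using cA[OF that] by (simp add: cond_def)
      fix D :: "'k set" and y assume D: "down D" "inaccessible_in D" "y \<in> D"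
      have "inj_on t {p \<in> A. fst (t p) < y}" using t_inj by (auto simp: inj_on_def)
      moreover have "t ` {p \<in> A. fst (t p) < y} \<subseteq> {\<eta> \<in> nodes UNIV. fst \<eta> \<le> y}" using t_nodes by auto
      ultimately have "{p \<in> A. fst (t p) < y} \<lesssim> {\<eta> \<in> nodes UNIV. fst \<eta> \<le> y}" unfolding lepoll_def by blast
      also have "\<dots> \<prec> D" by (rule nodes_upto_lesspoll[OF D(2,1,3)])
      finally show "{p \<in> A. fst (t p) < y} \<prec> D" .
    qed (rule gaps_inc)
  qed
  moreover have "N d \<in> idQ d" if d: "d \<in> S" for d
  proof -
    have si: "strongly_inaccessible d" using d S_inc by (auto simp: S_inc_def)
    have "inj_on t {p \<in> A. fst (t p) < d}" using t_inj by (auto simp: inj_on_def)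
    moreover have "t ` {p \<in> A. fst (t p) < d} \<subseteq> nodes (oseg d)" using t_nodes by (auto simp: nodes_def)
    ultimately have "{p \<in> A. fst (t p) < d} \<lesssim> nodes (oseg d)" unfolding lepoll_def by blast
    also have "\<dots> \<lesssim> oseg d"
      using si by (intro nodes_lepoll) (simp_all add: strongly_inaccessible_iff)
    finally have "(\<Union>p\<in>{p \<in> A. fst (t p) < d}. gap p d) \<in> idQ d"
      using si strongly_inaccessible_limit[OF si] cA by (intro UN_in_idQ gap_in_idQ[of UNIV]) auto
    moreover have "set0 (oseg d) ((\<lambda>p. p \<inter> nodes (oseg d)) ` {p \<in> A. fst (t p) < d}) \<in> idQ d" if "d \<in> T"
    proof -
      have "oseg d \<noteq> {}" using strongly_inaccessible_limit[OF si] by (auto simp: is_limit_def)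
      moreover have "predense (Qset (oseg d) idQ) ((\<lambda>p. p \<inter> nodes (oseg d)) ` {p \<in> A. fst (t p) < d})"
        using that by (simp add: T_def R_def)
      ultimately show ?thesis unfolding idQ_unfold[of d] by (intro set0_in_idset)
    qed
    ultimately show ?thesis unfolding N_def using si by (simp add: Un_in_idQ)
  qed
  moreover have "\<exists>d\<in>S. a \<le> d \<and> snd (restr x d) \<in> N d" if x: "x \<in> X" for x a
  proof (rule ccontr)
    assume "\<not> ?thesis"
    then have avoid: "\<And>d. \<lbrakk>d \<in> S; a \<le> d\<rbrakk> \<Longrightarrow> snd (restr x d) \<notin> N d" by blast
    obtain d where d: "d \<in> T" "a < d" using T_unbdd by blast
    have "d \<in> S" using d(1) by (simp add: S_def)
    then have "snd (restr x d) \<notin> N d" using avoid d(2) by simp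
    then have "snd (restr x d) \<notin> set0 (oseg d) ((\<lambda>p. p \<inter> nodes (oseg d)) ` {p \<in> A. fst (t p) < d})"
      using d(1) by (simp add: N_def)
    \<comment> \<open>Avoiding the points missed by the trace selects one member of \<open>A\<close>
      that contains \<open>x\<close> up to \<open>d\<close>. Avoiding the gaps then keeps
      \<open>x\<close> in this same member at all later levels.\<close>
    then obtain p where p: "p \<in> A" "fst (t p) < d" "snd (restr x d) \<in> branches (oseg d) (p \<inter> nodes (oseg d))"
      using snd_restr_funs[of x d] unfolding set0_def by blast
    have "restr x s \<in> p" if "s < d" for s
    proof -
      have "restr (snd (restr x d)) s \<in> p" using p(3) that by (simp add: branches_def)
      then show ?thesis using restr_restr[of s d x] that by simp
    qed
    then have "restr x s \<in> p" for s
    proof (intro branch_step[OF cA[OF p(1)] t[OF p(1)] _ p(2)])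
      fix e assume e: "d \<le> e" "e \<in> gaps UNIV p"
      have te: "fst (t p) < e" using p(2) e(1) by simp
      then have "e \<in> S" unfolding S_def using p(1) e(2) by blast
      then have "snd (restr x e) \<notin> N e" using avoid d(2) e(1) by (meson less_imp_le order_trans)
      then show "snd (restr x e) \<notin> gap p e" unfolding N_def using p(1) te by blast
    qed blast
    then have "x \<in> branches UNIV p" using x X unfolding branches_def by blast
    then show False using x XA p(1) unfolding set0_def by blast
  qed
  then have "X \<subseteq> {x \<in> funs UNIV. \<forall>a. \<exists>d\<in>S. a \<le> d \<and> snd (restr x d) \<in> N d}" using X by blast
  ultimately show "X \<in> id_minus" unfolding id_minus_def using X S_inc by blast
qed

theorem theorem3p6:
  assumes "weakly_compact TYPE('k::wellorder)"
  shows "(id_minus :: ('k \<Rightarrow> bool) set set) = wid"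
proof
  have "\<forall>a::'k. \<exists>b. a < b" using wc_gt[OF assms] by blast
  then show "(id_minus :: ('k \<Rightarrow> bool) set set) \<subseteq> wid" by (rule id_minus_subset_wid)
  show "(wid :: ('k \<Rightarrow> bool) set set) \<subseteq> id_minus" by (rule wid_subset_id_minus[OF assms])
qed

end
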